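(* Let $g_1,\dots,g_m\in\mathbb{R}[x_1,\dots,x_n]$ and assume that $S=\{x\in\mathbb{R}^n: g_1(x)\ge 0,\dots,g_m(x)\ge 0\}$ is a compact convex set with nonempty interior. If for every $u\in\partial S$ and every $i$ for which $g_i(u)=0$, the polynomial $g_i$ is either sos-concave or strictly quasi-concave at $u$, then $S$ is SDP representable.
   Context: A set $S\subseteq\mathbb{R}^n$ is SDP representable if there are $N\ge 0$ and real symmetric matrices $A_0,A_1,\dots,A_n,B_1,\dots,B_N$ of a common size such that $S=\{x\in\mathbb{R}^n:\exists u\in\mathbb{R}^N,\ A_0+\sum_{i=1}^n x_iA_i+\sum_{j=1}^N u_jB_j\succeq 0\}$, where $\succeq 0$ means positive semidefinite. $\partial S$ is the topological boundary. A polynomial $g$ is sos-concave if $-\nabla^2 g(x)=W(x)^TW(x)$ for some (possibly nonsquare) matrix polynomial $W(x)$. A smooth function $f$ is strictly quasi-concave at $u$ if $-v^T\nabla^2 f(u)v>0$ for all $0\ne v\in\mathbb{R}^n$ with $\nabla f(u)^Tv=0$ (in particular, if $\nabla f(u)=0$, this requires $-\nabla^2 f(u)$ to be positive definite). *)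

theory Defs
  imports "HOL-Analysis.Analysis"
begin

text \<open>
  Polynomials in \<open>n\<close> real variables are represented by the polynomial functions on
  \<open>real ^ 'n\<close> (\<^const>\<open>real_polynomial_function\<close>); over the infinite field of reals the
  two notions coincide. Matrices whose size is quantified inside a formula are functions on
  indices, of which only the entries below the stated bounds are ever inspected.
\<close>

definition gradient :: "(real ^ 'n \<Rightarrow> real) \<Rightarrow> real ^ 'n \<Rightarrow> real ^ 'n" where
  "gradient f x = (\<chi> i. frechet_derivative f (at x) (axis i 1))"

text \<open>Like \<^const>\<open>frechet_derivative\<close>, these are meaningful only for differentiable arguments.\<close>

definition hessian :: "(real ^ 'n \<Rightarrow> real) \<Rightarrow> real ^ 'n \<Rightarrow> real ^ 'n ^ 'n" where
  "hessian f x = jacobian (gradient f) (at x)"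

definition symmetric_matrix :: "nat \<Rightarrow> (nat \<Rightarrow> nat \<Rightarrow> real) \<Rightarrow> bool" where
  "symmetric_matrix k M \<longleftrightarrow> (\<forall>a<k. \<forall>b<k. M a b = M b a)"

definition psd_matrix :: "nat \<Rightarrow> (nat \<Rightarrow> nat \<Rightarrow> real) \<Rightarrow> bool" where
  "psd_matrix k M \<longleftrightarrow>
     symmetric_matrix k M \<and> (\<forall>v :: nat \<Rightarrow> real. (\<Sum>a<k. \<Sum>b<k. v a * M a b * v b) \<ge> 0)"

definition SDP_representable :: "(real ^ 'n) set \<Rightarrow> bool" where
  "SDP_representable S \<longleftrightarrow>
     (\<exists>(k :: nat) (N :: nat) (A0 :: nat \<Rightarrow> nat \<Rightarrow> real)
        (A :: 'n \<Rightarrow> nat \<Rightarrow> nat \<Rightarrow> real) (B :: nat \<Rightarrow> nat \<Rightarrow> nat \<Rightarrow> real).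
        symmetric_matrix k A0 \<and> (\<forall>i. symmetric_matrix k (A i)) \<and>
        (\<forall>j\<in>{1..N}. symmetric_matrix k (B j)) \<and>
        S = {x. \<exists>u :: nat \<Rightarrow> real.
               psd_matrix k (\<lambda>a b. A0 a b + (\<Sum>i\<in>UNIV. x $ i * A i a b)
                                          + (\<Sum>j=1..N. u j * B j a b))})"

text \<open>\<open>W\<close> is an \<open>r \<times> n\<close> matrix of polynomials; the equation says
  \<open>- hessian g x = (W x)\<^sup>T (W x)\<close> entry by entry.\<close>

definition sos_concave :: "(real ^ 'n \<Rightarrow> real) \<Rightarrow> bool" where
  "sos_concave g \<longleftrightarrow>
     (\<exists>(r :: nat) (W :: nat \<Rightarrow> 'n \<Rightarrow> real ^ 'n \<Rightarrow> real).
        (\<forall>l<r. \<forall>i. real_polynomial_function (W l i)) \<and>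
        (\<forall>x i j. (- hessian g x) $ i $ j = (\<Sum>l<r. W l i x * W l j x)))"

definition strictly_quasi_concave_at :: "(real ^ 'n \<Rightarrow> real) \<Rightarrow> real ^ 'n \<Rightarrow> bool" where
  "strictly_quasi_concave_at f u \<longleftrightarrow>
     (\<forall>v. v \<noteq> 0 \<longrightarrow> gradient f u \<bullet> v = 0 \<longrightarrow> - (v \<bullet> (hessian f u *v v)) > 0)"

end

theory Submission
  imports Defs
begin

text \<open>
  Call a linear functional \<open>L\<close> a pseudo-expectation on a small box around \<open>u \<in> S\<close> if
  \<open>L (q\<^sup>2) \<ge> 0\<close> and \<open>L ((\<delta>\<^sup>2 - (x\<^sub>i - u\<^sub>i)\<^sup>2) q\<^sup>2) \<ge> 0\<close> for all polynomials \<open>q\<close> of bounded degree; these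
  are linear matrix inequalities in \<open>L\<close>. With \<open>L 1 = 1\<close> and \<open>a = L x\<close>, the function
  \<open>\<phi> s = L (g (a + s (x - a)))\<close> satisfies \<open>\<phi>' 0 = 0\<close>, so \<open>\<phi>'' \<le> 0\<close> on \<open>[0, 1]\<close> gives Jensen's inequality
  \<open>L g = \<phi> 1 \<le> \<phi> 0 = g a\<close>. If \<open>g\<close> is sos-concave, \<open>-\<phi>''\<close> is \<open>L\<close> of a sum of squares. If \<open>g\<close> is strictly
  quasi-concave at \<open>u\<close>, replace it by \<open>g - (M/2) g\<^sup>2\<close>, which has the same sign near \<open>u\<close> and, for large
  \<open>M\<close>, a negative definite Hessian at \<open>u\<close>; on a small box the Hessian differs from its value at
  \<open>u\<close> by an amount which is small in the seminorms \<open>L (q\<^sup>2 f\<^sup>2)\<close>, so again \<open>\<phi>'' \<le> 0\<close>. Hence imposing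
  \<open>L (g q\<^sup>2) \<ge> 0\<close> for the active constraints forces \<open>L x \<in> S\<close>. Finitely many such boxes cover \<open>S\<close>, and
  \<open>x \<in> S\<close> iff \<open>x = \<Sum> L\<^sub>k x\<close> with unnormalised pseudo-expectations \<open>L\<^sub>k\<close> of total mass \<open>1\<close>.
\<close>

section \<open>Block linear matrix inequalities\<close>

text \<open>The rows of a block diagonal matrix are pairs (block, row), numbered by \<open>e\<close>
  because \<open>psd_matrix\<close> only knows indices below \<open>k\<close>. The quadratic form is
  the sum of the forms of the blocks, and a test vector for one block is extended by zero.\<close>

lemma block_psd_iff:
  fixes M :: "'c \<Rightarrow> 'r \<Rightarrow> 'r \<Rightarrow> real"
  assumes "finite C" and fR: "\<And>c. c \<in> C \<Longrightarrow> finite (R c)"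
    and e: "bij_betw e {..<k} (Sigma C R)"
  shows "(\<forall>v::nat \<Rightarrow> real. 0 \<le> (\<Sum>a<k. \<Sum>b<k.
            v a * (if fst (e a) = fst (e b) then M (fst (e a)) (snd (e a)) (snd (e b)) else 0) * v b))
     \<longleftrightarrow> (\<forall>c\<in>C. \<forall>v. 0 \<le> (\<Sum>r\<in>R c. \<Sum>s\<in>R c. v r * M c r s * v s))"
proof -
  define T where "T = Sigma C R"
  define K where "K t t' = (if fst t = fst t' then M (fst t) (snd t) (snd t') else 0)"
    for t t' :: "'c \<times> 'r"
  have quad: "(\<Sum>a<k. \<Sum>b<k. v (e a) * K (e a) (e b) * v (e b)) =
      (\<Sum>c\<in>C. \<Sum>r\<in>R c. \<Sum>s\<in>R c. v (c, r) * M c r s * v (c, s))" for v :: "'c \<times> 'r \<Rightarrow> real"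
  proof -
    have "(\<Sum>a<k. \<Sum>b<k. v (e a) * K (e a) (e b) * v (e b)) =
          (\<Sum>a<k. \<Sum>t'\<in>T. v (e a) * K (e a) t' * v t')"
      using e by (intro sum.cong refl sum.reindex_bij_betw) (simp add: T_def)
    also have "\<dots> = (\<Sum>t\<in>T. \<Sum>t'\<in>T. v t * K t t' * v t')"
      using e by (intro sum.reindex_bij_betw) (simp add: T_def)
    also have "\<dots> = (\<Sum>c\<in>C. \<Sum>r\<in>R c. \<Sum>t'\<in>T. v (c, r) * K (c, r) t' * v t')"
      unfolding T_def using assms(1) fR by (subst sum.Sigma) (auto simp: case_prod_beta)
    also have "\<dots> = (\<Sum>c\<in>C. \<Sum>r\<in>R c. \<Sum>s\<in>R c. v (c, r) * M c r s * v (c, s))"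
    proof (intro sum.cong refl)
      fix c r assume c: "c \<in> C" "r \<in> R c"
      have "(\<Sum>t'\<in>T. v (c, r) * K (c, r) t' * v t') =
            (\<Sum>c'\<in>C. \<Sum>s\<in>R c'. v (c, r) * K (c, r) (c', s) * v (c', s))"
        unfolding T_def using assms(1) fR by (subst sum.Sigma) (auto simp: case_prod_beta)
      also have "\<dots> = (\<Sum>c'\<in>C. if c' = c then (\<Sum>s\<in>R c. v (c, r) * M c r s * v (c, s)) else 0)"
        by (intro sum.cong refl) (auto simp: K_def)
      finally show "(\<Sum>t'\<in>T. v (c, r) * K (c, r) t' * v t') =
            (\<Sum>s\<in>R c. v (c, r) * M c r s * v (c, s))"
        using assms(1) c by simp
    qed
    finally show ?thesis .
  qed
  show ?thesis
  proof (intro iffI ballI allI)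
    fix c v assume L: "\<forall>v::nat \<Rightarrow> real. 0 \<le> (\<Sum>a<k. \<Sum>b<k.
            v a * (if fst (e a) = fst (e b) then M (fst (e a)) (snd (e a)) (snd (e b)) else 0) * v b)"
      and c: "c \<in> C"
    define v' where "v' t = (if fst t = c then v (snd t) else 0 :: real)" for t :: "'c \<times> 'r"
    have "0 \<le> (\<Sum>a<k. \<Sum>b<k. v' (e a) * K (e a) (e b) * v' (e b))"
      using L[rule_format, of "\<lambda>a. v' (e a)"] by (simp only: K_def)
    also have "\<dots> = (\<Sum>c'\<in>C. if c' = c then (\<Sum>r\<in>R c. \<Sum>s\<in>R c. v r * M c r s * v s) else 0)"
      unfolding quad by (intro sum.cong refl) (auto simp: v'_def)
    finally show "0 \<le> (\<Sum>r\<in>R c. \<Sum>s\<in>R c. v r * M c r s * v s)"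
      using assms(1) c by simp
  next
    fix v :: "nat \<Rightarrow> real"
    assume *: "\<forall>c\<in>C. \<forall>v. 0 \<le> (\<Sum>r\<in>R c. \<Sum>s\<in>R c. v r * M c r s * v s)"
    define v' where "v' = v \<circ> inv_into {..<k} e"
    have v': "v' (e a) = v a" if "a < k" for a
      using that e by (simp add: v'_def bij_betw_def)
    have "0 \<le> (\<Sum>c\<in>C. \<Sum>r\<in>R c. \<Sum>s\<in>R c. v' (c, r) * M c r s * v' (c, s))"
    proof (intro sum_nonneg[of C])
      fix c assume "c \<in> C"
      with * show "0 \<le> (\<Sum>r\<in>R c. \<Sum>s\<in>R c. v' (c, r) * M c r s * v' (c, s))"
        by (auto dest!: bspec spec[of _ "\<lambda>r. v' (c, r)"])
    qed
    also have "\<dots> = (\<Sum>a<k. \<Sum>b<k. v a * K (e a) (e b) * v b)"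
      unfolding quad[symmetric] by (intro sum.cong refl) (simp add: v')
    finally show "0 \<le> (\<Sum>a<k. \<Sum>b<k.
            v a * (if fst (e a) = fst (e b) then M (fst (e a)) (snd (e a)) (snd (e b)) else 0) * v b)"
      by (simp only: K_def)
  qed
qed

text \<open>Admits a finite family of linear matrix inequalities with arbitrary index types for
  blocks, rows and lifting variables; after renumbering they are the diagonal blocks of a single
  one.\<close>

lemma SDP_representableI:
  fixes A0 :: "'c \<Rightarrow> 'r \<Rightarrow> 'r \<Rightarrow> real" and A :: "'n::finite \<Rightarrow> 'c \<Rightarrow> 'r \<Rightarrow> 'r \<Rightarrow> real"
    and B :: "'j \<Rightarrow> 'c \<Rightarrow> 'r \<Rightarrow> 'r \<Rightarrow> real" and S :: "(real ^ 'n) set"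
  assumes "finite C" "finite J" and fR: "\<And>c. c \<in> C \<Longrightarrow> finite (R c)"
    and sym: "\<And>c r s. A0 c r s = A0 c s r" "\<And>i c r s. A i c r s = A i c s r"
      "\<And>j c r s. B j c r s = B j c s r"
    and S: "\<And>x. x \<in> S \<longleftrightarrow> (\<exists>w. \<forall>c\<in>C. \<forall>v. 0 \<le> (\<Sum>r\<in>R c. \<Sum>s\<in>R c.
       v r * (A0 c r s + (\<Sum>i\<in>UNIV. x $ i * A i c r s) + (\<Sum>j\<in>J. w j * B j c r s)) * v s))"
  shows "SDP_representable S"
proof -
  have "finite (Sigma C R)" using assms(1) fR by auto
  from ex_bij_betw_nat_finite[OF this] obtain e where e: "bij_betw e {..<card (Sigma C R)} (Sigma C R)"
    by (auto simp: atLeast0LessThan)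
  define k where "k = card (Sigma C R)"
  obtain \<pi> where \<pi>: "bij_betw \<pi> {1..card J} J"
    using ex_bij_betw_nat_finite_1[OF \<open>finite J\<close>] by auto
  define N where "N = card J"
  define blk where "blk M a b = (if fst (e a) = fst (e b) then M (fst (e a)) (snd (e a)) (snd (e b)) else 0)"
    for M :: "'c \<Rightarrow> 'r \<Rightarrow> 'r \<Rightarrow> real" and a b
  have eq: "blk A0 a b + (\<Sum>i\<in>UNIV. x $ i * blk (A i) a b) + (\<Sum>j=1..N. u j * blk (B (\<pi> j)) a b) =
     blk (\<lambda>c r s. A0 c r s + (\<Sum>i\<in>UNIV. x $ i * A i c r s) + (\<Sum>j=1..N. u j * B (\<pi> j) c r s)) a b"
    for x :: "real ^ 'n" and u a b by (simp add: blk_def)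
  have symb: "symmetric_matrix k (blk M)" if "\<And>c r s. M c r s = M c s r" for M
    unfolding symmetric_matrix_def blk_def using that by metis
  have psd: "psd_matrix k (blk M) \<longleftrightarrow> (\<forall>c\<in>C. \<forall>v. 0 \<le> (\<Sum>r\<in>R c. \<Sum>s\<in>R c. v r * M c r s * v s))"
    if "\<And>c r s. M c r s = M c s r" for M
    using block_psd_iff[OF assms(1) fR e, of M] symb[of M, OF that]
    unfolding psd_matrix_def blk_def k_def by simp
  have "x \<in> S \<longleftrightarrow> (\<exists>u. psd_matrix k (\<lambda>a b. blk A0 a b + (\<Sum>i\<in>UNIV. x $ i * blk (A i) a b)
      + (\<Sum>j=1..N. u j * blk (B (\<pi> j)) a b)))" for x
  proof -
    define P where "P Z \<longleftrightarrow> (\<forall>c\<in>C. \<forall>v. 0 \<le> (\<Sum>r\<in>R c. \<Sum>s\<in>R c.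
       v r * (A0 c r s + (\<Sum>i\<in>UNIV. x $ i * A i c r s) + Z c r s) * v s))" for Z
    have "x \<in> S \<longleftrightarrow> (\<exists>w. P (\<lambda>c r s. \<Sum>j\<in>J. w j * B j c r s))"
      unfolding S P_def ..
    also have "\<dots> \<longleftrightarrow> (\<exists>u. P (\<lambda>c r s. \<Sum>j=1..N. u j * B (\<pi> j) c r s))"
    proof
      assume "\<exists>w. P (\<lambda>c r s. \<Sum>j\<in>J. w j * B j c r s)"
      then obtain w where "P (\<lambda>c r s. \<Sum>j\<in>J. w j * B j c r s)" ..
      also have "(\<lambda>c r s. \<Sum>j\<in>J. w j * B j c r s) = (\<lambda>c r s. \<Sum>j=1..N. w (\<pi> j) * B (\<pi> j) c r s)"
        using sum.reindex_bij_betw[OF \<pi>, symmetric] unfolding N_def by fastforce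
      finally have "P (\<lambda>c r s. \<Sum>j=1..N. w (\<pi> j) * B (\<pi> j) c r s)" .
      then show "\<exists>u. P (\<lambda>c r s. \<Sum>j=1..N. u j * B (\<pi> j) c r s)"
        by (intro exI[of _ "\<lambda>j. w (\<pi> j)"])
    next
      assume "\<exists>u. P (\<lambda>c r s. \<Sum>j=1..N. u j * B (\<pi> j) c r s)"
      then obtain u where u: "P (\<lambda>c r s. \<Sum>j=1..N. u j * B (\<pi> j) c r s)" ..
      define w where "w = u \<circ> inv_into {1..N} \<pi>"
      have w: "w (\<pi> j) = u j" if "j \<in> {1..N}" for j
        using that \<pi> by (simp add: w_def bij_betw_def N_def)
      have "(\<Sum>j\<in>J. w j * B j c r s) = (\<Sum>j=1..N. u j * B (\<pi> j) c r s)" for c r s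
      proof -
        have "(\<Sum>j\<in>J. w j * B j c r s) = (\<Sum>j=1..N. w (\<pi> j) * B (\<pi> j) c r s)"
          using sum.reindex_bij_betw[OF \<pi>, of "\<lambda>j. w j * B j c r s"] by (simp add: N_def)
        also have "\<dots> = (\<Sum>j=1..N. u j * B (\<pi> j) c r s)"
          by (intro sum.cong refl) (simp only: w)
        finally show ?thesis .
      qed
      with u show "\<exists>w. P (\<lambda>c r s. \<Sum>j\<in>J. w j * B j c r s)"
        by (intro exI[of _ w]) simp
    qed
    also have "\<dots> \<longleftrightarrow> (\<exists>u. psd_matrix k (\<lambda>a b. blk A0 a b + (\<Sum>i\<in>UNIV. x $ i * blk (A i) a b)
      + (\<Sum>j=1..N. u j * blk (B (\<pi> j)) a b)))"
    proof -
      have "P (\<lambda>c r s. \<Sum>j=1..N. u j * B (\<pi> j) c r s) \<longleftrightarrow> psd_matrix k (blk (\<lambda>c r s. A0 c r s +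
         (\<Sum>i\<in>UNIV. x $ i * A i c r s) + (\<Sum>j=1..N. u j * B (\<pi> j) c r s)))" for u
        unfolding P_def by (rule psd[symmetric]) (metis (no_types, lifting) sym sum.cong)
      then show ?thesis unfolding eq by simp
    qed
    finally show ?thesis .
  qed
  hence "S = {x. \<exists>u. psd_matrix k (\<lambda>a b. blk A0 a b + (\<Sum>i\<in>UNIV. x $ i * blk (A i) a b)
      + (\<Sum>j=1..N. u j * blk (B (\<pi> j)) a b))}" by blast
  moreover have "symmetric_matrix k (blk A0)" "\<forall>i. symmetric_matrix k (blk (A i))"
    "\<forall>j\<in>{1..N}. symmetric_matrix k (blk (B (\<pi> j)))"
    using sym by (blast intro!: symb)+
  ultimately show ?thesis unfolding SDP_representable_def
    by (intro exI[of _ k] exI[of _ N] exI[of _ "blk A0"] exI[of _ "\<lambda>i. blk (A i)"]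
        exI[of _ "\<lambda>j. blk (B (\<pi> j))"] conjI)
qed

section \<open>Polynomials of bounded degree\<close>

text \<open>An upper bound for the total degree, not the degree itself. Multiplying by one
  coordinate at a time reduces inductions on products to a single linear factor.\<close>

inductive pdeg :: "nat \<Rightarrow> (real ^ 'n \<Rightarrow> real) \<Rightarrow> bool" where
  pdeg_const: "pdeg d (\<lambda>x. c)"
| pdeg_coord: "pdeg d f \<Longrightarrow> pdeg (Suc d) (\<lambda>x. x $ i * f x)"
| pdeg_add: "pdeg d f \<Longrightarrow> pdeg d g \<Longrightarrow> pdeg d (\<lambda>x. f x + g x)"
| pdeg_Suc: "pdeg d f \<Longrightarrow> pdeg (Suc d) f"

lemma pdeg_mono: "pdeg d f \<Longrightarrow> d \<le> e \<Longrightarrow> pdeg e f"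
  by (induction e) (auto simp: le_Suc_eq intro: pdeg_Suc)

lemma pdeg_cmult: "pdeg d f \<Longrightarrow> pdeg d (\<lambda>x. c * f x)"
proof (induction rule: pdeg.induct)
  case (pdeg_coord d f i)
  from pdeg.pdeg_coord[OF pdeg_coord.IH, of i] show ?case by (simp add: mult.left_commute)
qed (auto intro: pdeg.intros simp: distrib_left)

lemma pdeg_diff: "pdeg d f \<Longrightarrow> pdeg d g \<Longrightarrow> pdeg d (\<lambda>x. f x - g x)"
  using pdeg_add[of d f "\<lambda>x. (-1) * g x"] pdeg_cmult[of d g "-1"] by simp

lemma pdeg_sum: "finite I \<Longrightarrow> (\<And>i. i \<in> I \<Longrightarrow> pdeg d (F i)) \<Longrightarrow> pdeg d (\<lambda>x. \<Sum>i\<in>I. F i x)"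
  by (induction I rule: finite_induct) (auto intro: pdeg_const pdeg_add)

lemma pdeg_mult: "pdeg d f \<Longrightarrow> pdeg e g \<Longrightarrow> pdeg (d + e) (\<lambda>x. f x * g x)"
proof (induction rule: pdeg.induct)
  case (pdeg_const d c)
  then show ?case using pdeg_mono[OF pdeg_cmult, of e g "d + e" c] by simp
next
  case (pdeg_coord d f i)
  from pdeg.pdeg_coord[OF pdeg_coord.IH[OF pdeg_coord.prems], of i] show ?case
    by (simp add: mult.assoc)
qed (auto intro: pdeg.intros simp: distrib_right)

text \<open>Each coordinate of the contracted point is a constant plus \<open>s * x $ i\<close>.
  This substitution is the one made along segments in Jensen's inequality.\<close>

lemma pdeg_affine: "pdeg d f \<Longrightarrow> pdeg d (\<lambda>x. f (a + s *\<^sub>R (x - a)))"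
proof (induction rule: pdeg.induct)
  case (pdeg_coord d f i)
  let ?f = "\<lambda>x. f (a + s *\<^sub>R (x - a))"
  have "pdeg (Suc d) (\<lambda>x. (a $ i - s * a $ i) * ?f x + s * (x $ i * ?f x))"
    by (intro pdeg_add pdeg_cmult pdeg.pdeg_coord pdeg_Suc pdeg_coord.IH)
  then show ?case by (rule back_subst[of "pdeg (Suc d)"]) (simp add: fun_eq_iff algebra_simps)
qed (auto intro: pdeg.intros)

lemma pdeg_coord_diff: "pdeg (Suc 0) (\<lambda>x. x $ i - c)"
  using pdeg_diff[OF pdeg_coord[OF pdeg_const[of 0 1], of i] pdeg_const[of _ c]] by simp

lemma real_polynomial_function_imp_pdeg:
  fixes f :: "real ^ 'n \<Rightarrow> real"
  assumes "real_polynomial_function f"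
  shows "\<exists>d. pdeg d f"
  using assms
proof (induction rule: real_polynomial_function.induct)
  case (linear f)
  have "f x = (\<Sum>i\<in>UNIV. x $ i * f (axis i 1))" for x :: "real ^ 'n"
  proof -
    have "f x = f (\<Sum>i\<in>UNIV. x $ i *\<^sub>R axis i 1)"
      by (simp only: basis_expansion scalar_mult_eq_scaleR[symmetric])
    then show ?thesis
      using linear by (simp add: linear_sum bounded_linear.linear linear_cmul o_def)
  qed
  moreover have "pdeg (Suc 0) (\<lambda>x :: real ^ 'n. \<Sum>i\<in>UNIV. x $ i * f (axis i 1))"
    by (intro pdeg_sum pdeg_coord pdeg_const) simp
  ultimately have "f = (\<lambda>x. \<Sum>i\<in>UNIV. x $ i * f (axis i 1))" by blast
  then show ?case using \<open>pdeg (Suc 0) _\<close> by metis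
next
  case (add f g)
  then obtain d e where "pdeg d f" "pdeg e g" by auto
  then have "pdeg (max d e) (\<lambda>x. f x + g x)" by (intro pdeg_add) (auto elim: pdeg_mono)
  then show ?case by blast
qed (auto intro: pdeg_const pdeg_mult)

section \<open>Finite-dimensional spaces of polynomials\<close>

text \<open>The coefficients \<open>c\<close> later serve as the test vector of a quadratic form, so
  that letting \<open>q\<close> range over the span expresses semidefiniteness of a matrix indexed
  by \<open>B\<close>.\<close>

definition fspan :: "('a \<Rightarrow> real) set \<Rightarrow> ('a \<Rightarrow> real) set" where
  "fspan B = {f. \<exists>c. f = (\<lambda>x. \<Sum>b\<in>B. c b * b x)}"

lemma fspan_base: "finite B \<Longrightarrow> b \<in> B \<Longrightarrow> b \<in> fspan B"
  unfolding fspan_def by (auto intro!: exI[of _ "\<lambda>b'. if b' = b then 1 else 0"]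
      simp: if_distrib[of "\<lambda>t. t * _"] cong: if_cong)

lemma fspan_add: "f \<in> fspan B \<Longrightarrow> g \<in> fspan B \<Longrightarrow> (\<lambda>x. f x + g x) \<in> fspan B"
proof -
  assume "f \<in> fspan B" "g \<in> fspan B"
  then obtain c c' where "f = (\<lambda>x. \<Sum>b\<in>B. c b * b x)" "g = (\<lambda>x. \<Sum>b\<in>B. c' b * b x)"
    by (auto simp: fspan_def)
  then show ?thesis
    by (auto simp: fspan_def sum.distrib distrib_right intro!: exI[of _ "\<lambda>b. c b + c' b"])
qed

lemma fspan_cmult: "f \<in> fspan B \<Longrightarrow> (\<lambda>x. a * f x) \<in> fspan B"
proof -
  assume "f \<in> fspan B"
  then obtain c where "f = (\<lambda>x. \<Sum>b\<in>B. c b * b x)" by (auto simp: fspan_def)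
  then show ?thesis
    by (auto simp: fspan_def sum_distrib_left mult.assoc intro!: exI[of _ "\<lambda>b. a * c b"])
qed

lemma fspan_sum: "(\<And>i. i \<in> I \<Longrightarrow> F i \<in> fspan B) \<Longrightarrow> (\<lambda>x. \<Sum>i\<in>I. F i x) \<in> fspan B"
proof (induction I rule: infinite_finite_induct)
  case (insert i I)
  then show ?case by (auto intro: fspan_add)
qed (auto simp: fspan_def intro: exI[of _ "\<lambda>_. 0"])

text \<open>The monomials of degree at most \<open>d\<close> generate. Finiteness turns a condition
  on all squares of bounded degree into one finite matrix inequality.\<close>

lemma pdeg_finite_span:
  "\<exists>B. finite B \<and> (\<forall>f :: real ^ 'n \<Rightarrow> real. pdeg d f \<longrightarrow> f \<in> fspan B)"
proof -
  define mons :: "nat \<Rightarrow> (real ^ 'n \<Rightarrow> real) set" where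
    "mons = rec_nat {\<lambda>_. 1} (\<lambda>_ B. B \<union> (\<lambda>(i, b) x. x $ i * b x) ` (UNIV \<times> B))"
  have mons_Suc: "mons (Suc d) = mons d \<union> (\<lambda>(i, b) x. x $ i * b x) ` (UNIV \<times> mons d)" for d
    by (simp add: mons_def)
  have fin: "finite (mons d)" for d
    by (induction d) (auto simp: mons_Suc, simp add: mons_def)
  have one: "(\<lambda>_. 1) \<in> mons d" for d
    by (induction d) (auto simp: mons_Suc, simp add: mons_def)
  have "pdeg d f \<Longrightarrow> f \<in> fspan (mons d)" for f
  proof (induction rule: pdeg.induct)
    case (pdeg_const d c)
    from fspan_cmult[OF fspan_base[OF fin one], of c] show ?case by simp
  next
    case (pdeg_coord d f i)
    then obtain c where c: "f = (\<lambda>x. \<Sum>b\<in>mons d. c b * b x)" by (auto simp: fspan_def)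
    have "(\<lambda>x. \<Sum>b\<in>mons d. c b * (x $ i * b x)) \<in> fspan (mons (Suc d))"
      by (intro fspan_sum fspan_cmult fspan_base fin) (auto simp: mons_Suc)
    then show ?case by (simp add: c sum_distrib_left mult.left_commute)
  next
    case (pdeg_Suc d f)
    then obtain c where c: "f = (\<lambda>x. \<Sum>b\<in>mons d. c b * b x)" by (auto simp: fspan_def)
    have "(\<lambda>x. \<Sum>b\<in>mons d. c b * b x) \<in> fspan (mons (Suc d))"
      by (intro fspan_sum fspan_cmult fspan_base fin) (auto simp: mons_Suc)
    then show ?case by (simp add: c)
  qed (auto intro: fspan_add)
  then show ?thesis using fin by blast
qed

section \<open>Pseudo-expectations\<close>

text \<open>
  A functional on polynomials of bounded degree is represented by its weights at finitely many
  points, so it is linear on all functions and no basis of monomials is needed. The weights may be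
  negative.
\<close>

definition pexp :: "'a set \<Rightarrow> ('a \<Rightarrow> real) \<Rightarrow> ('a \<Rightarrow> real) \<Rightarrow> real" where
  "pexp P w f = (\<Sum>p\<in>P. w p * f p)"

lemma pexp_add: "pexp P w (\<lambda>x. f x + g x) = pexp P w f + pexp P w g"
  by (simp add: pexp_def sum.distrib distrib_left)

lemma pexp_diff: "pexp P w (\<lambda>x. f x - g x) = pexp P w f - pexp P w g"
  by (simp add: pexp_def sum_subtractf right_diff_distrib)

lemma pexp_cmult: "pexp P w (\<lambda>x. c * f x) = c * pexp P w f"
  by (simp add: pexp_def sum_distrib_left mult.left_commute)

lemma pexp_sum: "pexp P w (\<lambda>x. \<Sum>i\<in>I. F i x) = (\<Sum>i\<in>I. pexp P w (F i))"
  unfolding pexp_def by (simp add: sum_distrib_left sum.swap[of _ P])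

lemma pexp_const: "pexp P w (\<lambda>x. c) = c * pexp P w (\<lambda>x. 1)"
  using pexp_cmult[of P w c "\<lambda>x. 1"] by simp

text \<open>Semidefiniteness of the localizing matrix of \<open>h\<close>; \<open>D\<close> bounds
  the degree of \<open>q\<close> and not that of the whole product.\<close>

definition sq_nonneg :: "(real ^ 'n) set \<Rightarrow> (real ^ 'n \<Rightarrow> real) \<Rightarrow> nat \<Rightarrow> (real ^ 'n \<Rightarrow> real) \<Rightarrow> bool" where
  "sq_nonneg P w D h \<longleftrightarrow> (\<forall>q. pdeg D q \<longrightarrow> 0 \<le> pexp P w (\<lambda>x. h x * (q x)\<^sup>2))"

text \<open>The mass \<open>L 1\<close> is left free, since the pieces of a decomposition carry
  different masses, possibly zero.\<close>

definition box_pseudoexp :: "(real ^ 'n) set \<Rightarrow> (real ^ 'n \<Rightarrow> real) \<Rightarrow> real ^ 'n \<Rightarrow> real \<Rightarrow> nat \<Rightarrow> bool" where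
  "box_pseudoexp P w u \<delta> D \<longleftrightarrow> sq_nonneg P w D (\<lambda>_. 1) \<and>
     (\<forall>i. sq_nonneg P w D (\<lambda>x. \<delta>\<^sup>2 - (x $ i - u $ i)\<^sup>2))"

lemma box_pseudoexp_sq: "box_pseudoexp P w u \<delta> D \<Longrightarrow> pdeg D q \<Longrightarrow> 0 \<le> pexp P w (\<lambda>x. (q x)\<^sup>2)"
  by (simp add: box_pseudoexp_def sq_nonneg_def)

lemma box_pseudoexp_box:
  assumes "box_pseudoexp P w u \<delta> D" "pdeg D q"
  shows "pexp P w (\<lambda>x. (q x)\<^sup>2 * (x $ i - u $ i)\<^sup>2) \<le> \<delta>\<^sup>2 * pexp P w (\<lambda>x. (q x)\<^sup>2)"
proof -
  have "0 \<le> pexp P w (\<lambda>x. (\<delta>\<^sup>2 - (x $ i - u $ i)\<^sup>2) * (q x)\<^sup>2)"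
    using assms by (simp add: box_pseudoexp_def sq_nonneg_def)
  also have "\<dots> = \<delta>\<^sup>2 * pexp P w (\<lambda>x. (q x)\<^sup>2) - pexp P w (\<lambda>x. (q x)\<^sup>2 * (x $ i - u $ i)\<^sup>2)"
    unfolding pexp_cmult[symmetric] pexp_diff[symmetric] by (simp add: algebra_simps)
  finally show ?thesis by simp
qed

section \<open>Interpolation at finitely many points\<close>

text \<open>Evaluation at any point agrees on \<open>F\<close> with a weighted sum of evaluations at
  \<open>P\<close>, so true point evaluations are available as \<open>pexp\<close>. For each new
  function at most one point is added, one at which the old formula fails for it.\<close>

lemma interpolation_points:
  fixes F :: "('a \<Rightarrow> real) set"
  assumes "finite F"
  shows "\<exists>P. finite P \<and> (\<forall>x. \<exists>w. \<forall>f\<in>F. f x = (\<Sum>p\<in>P. w p * f p))"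
  using assms
proof (induction F rule: finite_induct)
  case empty
  show ?case by auto
next
  case (insert f F)
  then obtain P w where P: "finite P" and w: "\<And>x h. h \<in> F \<Longrightarrow> h x = (\<Sum>p\<in>P. w x p * h p)"
    by metis
  define r where "r x = f x - (\<Sum>p\<in>P. w x p * f p)" for x
  show ?case
  proof (cases "\<forall>x. r x = 0")
    case True
    have "h x = (\<Sum>p\<in>P. w x p * h p)" if "h \<in> insert f F" for h x
      using that w[of h x] True[rule_format, of x] by (cases "h = f") (simp_all only: r_def insert_iff, simp_all)
    then have "\<forall>x. \<exists>w. \<forall>h\<in>insert f F. h x = (\<Sum>p\<in>P. w p * h p)" by (intro allI exI ballI)
    then show ?thesis using P by (intro exI conjI)
  next
    case False
    then obtain x0 where x0: "r x0 \<noteq> 0" by auto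
    \<comment> \<open>Evaluation at \<open>x0\<close> minus its own old formula vanishes on
      \<open>F\<close> and equals \<open>r x0\<close> on \<open>f\<close>; the multiple
      \<open>r x / r x0\<close> of it repairs the error at \<open>x\<close>. The two summands also
      cover the case that \<open>x0\<close> is already in \<open>P\<close>.\<close>
    define W where "W x p = (if p \<in> P then w x p - r x / r x0 * w x0 p else 0) +
      (if p = x0 then r x / r x0 else 0)" for x p
    have W: "(\<Sum>p\<in>insert x0 P. W x p * h p) = (\<Sum>p\<in>P. w x p * h p) +
        r x / r x0 * (h x0 - (\<Sum>p\<in>P. w x0 p * h p))" for x h
    proof -
      have "(\<Sum>p\<in>insert x0 P. W x p * h p) =
        (\<Sum>p\<in>insert x0 P. if p \<in> P then (w x p - r x / r x0 * w x0 p) * h p else 0) +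
        (\<Sum>p\<in>insert x0 P. if p = x0 then r x / r x0 * h p else 0)"
        unfolding W_def sum.distrib[symmetric] by (intro sum.cong) (auto simp: algebra_simps)
      also have "(\<Sum>p\<in>insert x0 P. if p \<in> P then (w x p - r x / r x0 * w x0 p) * h p else 0) =
        (\<Sum>p\<in>P. (w x p - r x / r x0 * w x0 p) * h p)"
        using P by (intro sum.mono_neutral_cong_right) auto
      also have "(\<Sum>p\<in>insert x0 P. if p = x0 then r x / r x0 * h p else 0) = r x / r x0 * h x0"
        using P by (subst sum.delta) auto
      finally show ?thesis
        by (simp add: left_diff_distrib right_diff_distrib sum_subtractf sum_distrib_left mult.assoc)
    qed
    have "h x = (\<Sum>p\<in>insert x0 P. W x p * h p)" if "h \<in> insert f F" for h x
    proof (cases "h = f")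
      case True
      then show ?thesis using x0 unfolding W by (simp add: r_def[symmetric]) (simp add: r_def)
    next
      case False
      then have "h \<in> F" using that by auto
      then show ?thesis unfolding W w[OF \<open>h \<in> F\<close>, of x, symmetric] w[OF \<open>h \<in> F\<close>, of x0, symmetric]
        by simp
    qed
    then have "\<forall>x. \<exists>w. \<forall>h\<in>insert f F. h x = (\<Sum>p\<in>insert x0 P. w p * h p)"
      by (intro allI exI ballI)
    then show ?thesis using P by (intro exI[of _ "insert x0 P"] conjI) simp_all
  qed
qed

text \<open>Multiplication by \<open>f\<close> has norm at most \<open>sqrt K\<close> for the seminorm \<open>q \<mapsto> sqrt (L (q\<^sup>2))\<close>.\<close>

definition sq_bounded ::
  "(real ^ 'n) set \<Rightarrow> (real ^ 'n \<Rightarrow> real) \<Rightarrow> nat \<Rightarrow> (real ^ 'n \<Rightarrow> real) \<Rightarrow> real \<Rightarrow> bool" where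
  "sq_bounded P w e f K \<longleftrightarrow>
     (\<forall>q. pdeg e q \<longrightarrow> pexp P w (\<lambda>x. (q x)\<^sup>2 * (f x)\<^sup>2) \<le> K * pexp P w (\<lambda>x. (q x)\<^sup>2))"

text \<open>Parallelogram law: (f+g)^2 + (f-g)^2 = 2f^2 + 2g^2, where the square of
  \<open>q * (f - g)\<close> is dropped. Its degree is at most \<open>e + d\<close>, hence the bound
  on \<open>D\<close>.\<close>

lemma sq_bounded_add:
  assumes L: "sq_nonneg P w D (\<lambda>_. 1)" and f: "sq_bounded P w e f K" "pdeg d f"
    and g: "sq_bounded P w e g K'" "pdeg d g" and "e + d \<le> D"
  shows "sq_bounded P w e (\<lambda>x. f x + g x) (2 * (K + K'))"
  unfolding sq_bounded_def
proof (intro allI impI)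
  fix q :: "real ^ 'a \<Rightarrow> real" assume q: "pdeg e q"
  have "pdeg D (\<lambda>x. q x * (f x - g x))"
    by (rule pdeg_mono[OF pdeg_mult[OF q pdeg_diff[OF f(2) g(2)]] assms(6)])
  then have "0 \<le> pexp P w (\<lambda>x. (q x * (f x - g x))\<^sup>2)"
    using L by (simp add: sq_nonneg_def)
  moreover have "pexp P w (\<lambda>x. (q x)\<^sup>2 * (f x + g x)\<^sup>2) + pexp P w (\<lambda>x. (q x * (f x - g x))\<^sup>2) =
      2 * pexp P w (\<lambda>x. (q x)\<^sup>2 * (f x)\<^sup>2) + 2 * pexp P w (\<lambda>x. (q x)\<^sup>2 * (g x)\<^sup>2)"
    unfolding pexp_cmult[symmetric] pexp_add[symmetric] by (simp add: power2_eq_square algebra_simps)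
  moreover have "pexp P w (\<lambda>x. (q x)\<^sup>2 * (f x)\<^sup>2) \<le> K * pexp P w (\<lambda>x. (q x)\<^sup>2)"
    "pexp P w (\<lambda>x. (q x)\<^sup>2 * (g x)\<^sup>2) \<le> K' * pexp P w (\<lambda>x. (q x)\<^sup>2)"
    using f g q by (auto simp: sq_bounded_def)
  ultimately show "pexp P w (\<lambda>x. (q x)\<^sup>2 * (f x + g x)\<^sup>2) \<le> 2 * (K + K') * pexp P w (\<lambda>x. (q x)\<^sup>2)"
    by (simp add: distrib_right)
qed

text \<open>The bound for \<open>g\<close> is applied to \<open>q * f\<close>, so it must be
  available up to degree \<open>e + d\<close>.\<close>

lemma sq_bounded_mult:
  assumes f: "sq_bounded P w e f K" "pdeg d f"
    and g: "sq_bounded P w (e + d) g K'" "0 \<le> K'"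
  shows "sq_bounded P w e (\<lambda>x. f x * g x) (K * K')"
  unfolding sq_bounded_def
proof (intro allI impI)
  fix q :: "real ^ 'a \<Rightarrow> real" assume q: "pdeg e q"
  have "pexp P w (\<lambda>x. (q x)\<^sup>2 * (f x * g x)\<^sup>2) = pexp P w (\<lambda>x. (q x * f x)\<^sup>2 * (g x)\<^sup>2)"
    by (simp add: power_mult_distrib mult.assoc)
  also have "\<dots> \<le> K' * pexp P w (\<lambda>x. (q x * f x)\<^sup>2)"
    using g pdeg_mult[OF q f(2)] unfolding sq_bounded_def by blast
  also have "\<dots> \<le> K' * (K * pexp P w (\<lambda>x. (q x)\<^sup>2))"
    using f q g(2) by (intro mult_left_mono) (auto simp: sq_bounded_def power_mult_distrib)
  finally show "pexp P w (\<lambda>x. (q x)\<^sup>2 * (f x * g x)\<^sup>2) \<le> K * K' * pexp P w (\<lambda>x. (q x)\<^sup>2)"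
    by (simp add: algebra_simps)
qed

lemma sq_bounded_cmult:
  assumes "sq_bounded P w e f K"
  shows "sq_bounded P w e (\<lambda>x. c * f x) (c\<^sup>2 * K)"
  unfolding sq_bounded_def
proof (intro allI impI)
  fix q :: "real ^ 'a \<Rightarrow> real" assume q: "pdeg e q"
  have "pexp P w (\<lambda>x. (q x)\<^sup>2 * (c * f x)\<^sup>2) = c\<^sup>2 * pexp P w (\<lambda>x. (q x)\<^sup>2 * (f x)\<^sup>2)"
    unfolding pexp_cmult[symmetric] by (simp add: power_mult_distrib mult.left_commute)
  also have "\<dots> \<le> c\<^sup>2 * (K * pexp P w (\<lambda>x. (q x)\<^sup>2))"
    using assms q by (intro mult_left_mono) (auto simp: sq_bounded_def)
  finally show "pexp P w (\<lambda>x. (q x)\<^sup>2 * (c * f x)\<^sup>2) \<le> c\<^sup>2 * K * pexp P w (\<lambda>x. (q x)\<^sup>2)"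
    by simp
qed

lemma sq_bounded_weaken:
  assumes "sq_bounded P w e f K" "sq_nonneg P w D (\<lambda>_. 1)" "e \<le> D" "K \<le> K'"
  shows "sq_bounded P w e f K'"
  unfolding sq_bounded_def
proof (intro allI impI)
  fix q :: "real ^ 'a \<Rightarrow> real" assume q: "pdeg e q"
  then have "0 \<le> pexp P w (\<lambda>x. (q x)\<^sup>2)"
    using assms(2,3) by (auto simp: sq_nonneg_def dest: pdeg_mono)
  then have "K * pexp P w (\<lambda>x. (q x)\<^sup>2) \<le> K' * pexp P w (\<lambda>x. (q x)\<^sup>2)"
    using assms(4) by (rule mult_right_mono[rotated])
  then show "pexp P w (\<lambda>x. (q x)\<^sup>2 * (f x)\<^sup>2) \<le> K' * pexp P w (\<lambda>x. (q x)\<^sup>2)"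
    using assms(1) q by (force simp: sq_bounded_def)
qed

text \<open>Convexity of the square as an identity: ((1-s)A + sB)^2 = (1-s)A^2 + sB^2 -
  s(1-s)(B-A)^2 with A = a_i - u_i and B = x_i - u_i. The last term has the right sign, and both
  remaining ones are bounded by \<delta>^2.\<close>

lemma sq_bounded_coord:
  assumes L: "box_pseudoexp P w u \<delta> D" and a: "\<bar>a $ i - u $ i\<bar> \<le> \<delta>" and s: "0 \<le> s" "s \<le> 1"
    and e: "Suc e \<le> D"
  shows "sq_bounded P w e (\<lambda>x. (a + s *\<^sub>R (x - a)) $ i - u $ i) (\<delta>\<^sup>2)"
  unfolding sq_bounded_def
proof (intro allI impI)
  fix q :: "real ^ 'a \<Rightarrow> real" assume q: "pdeg e q"
  let ?L = "pexp P w" and ?\<alpha> = "a $ i - u $ i"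
  have qD: "pdeg D q" by (rule pdeg_mono[OF q]) (use e in simp)
  have "pdeg (e + Suc 0) (\<lambda>x. q x * (x $ i - a $ i))" by (rule pdeg_mult[OF q pdeg_coord_diff])
  then have "0 \<le> ?L (\<lambda>x. (q x * (x $ i - a $ i))\<^sup>2)"
    using e by (intro box_pseudoexp_sq[OF L] pdeg_mono[of "e + Suc 0" _ D]) auto
  then have "0 \<le> s * (1 - s) * ?L (\<lambda>x. (q x * (x $ i - a $ i))\<^sup>2)" using s by simp
  moreover have "?L (\<lambda>x. (q x)\<^sup>2 * ((a + s *\<^sub>R (x - a)) $ i - u $ i)\<^sup>2) +
      s * (1 - s) * ?L (\<lambda>x. (q x * (x $ i - a $ i))\<^sup>2) =
      (1 - s) * ?\<alpha>\<^sup>2 * ?L (\<lambda>x. (q x)\<^sup>2) + s * ?L (\<lambda>x. (q x)\<^sup>2 * (x $ i - u $ i)\<^sup>2)"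
    unfolding pexp_cmult[symmetric] pexp_add[symmetric] by (simp add: power2_eq_square algebra_simps)
  moreover have "s * ?L (\<lambda>x. (q x)\<^sup>2 * (x $ i - u $ i)\<^sup>2) \<le> s * (\<delta>\<^sup>2 * ?L (\<lambda>x. (q x)\<^sup>2))"
    using box_pseudoexp_box[OF L qD] s by (intro mult_left_mono)
  moreover have "(1 - s) * ?\<alpha>\<^sup>2 * ?L (\<lambda>x. (q x)\<^sup>2) \<le> (1 - s) * \<delta>\<^sup>2 * ?L (\<lambda>x. (q x)\<^sup>2)"
    using s box_pseudoexp_sq[OF L qD] power_mono[OF a, of 2]
    by (intro mult_right_mono mult_left_mono) auto
  ultimately show "?L (\<lambda>x. (q x)\<^sup>2 * ((a + s *\<^sub>R (x - a)) $ i - u $ i)\<^sup>2) \<le> \<delta>\<^sup>2 * ?L (\<lambda>x. (q x)\<^sup>2)"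
    by (simp add: algebra_simps)
qed

text \<open>A polynomial varies by O(\<delta>) on the box, in the operator seminorm. The constant
  depends only on \<open>f\<close> and \<open>u\<close>, not on the functional, the segment or the
  degrees, so that \<delta> can be chosen after it.\<close>

lemma sq_bounded_oscillation:
  fixes u :: "real ^ 'n"
  assumes "pdeg d f"
  shows "\<exists>C\<ge>0. \<forall>P w \<delta> D a s e. box_pseudoexp P w u \<delta> D \<longrightarrow> \<delta> \<le> 1 \<longrightarrow> 0 \<le> \<delta> \<longrightarrow>
     (\<forall>i. \<bar>a $ i - u $ i\<bar> \<le> \<delta>) \<longrightarrow> 0 \<le> s \<longrightarrow> s \<le> 1 \<longrightarrow> e + d \<le> D \<longrightarrow>
     sq_bounded P w e (\<lambda>x. f (a + s *\<^sub>R (x - a)) - f u) (C * \<delta>\<^sup>2)"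
  using assms
proof (induction rule: pdeg.induct)
  case (pdeg_const d c)
  show ?case by (intro exI[of _ 0]) (auto simp: sq_bounded_def pexp_def)
next
  case (pdeg_coord d f i)
  then obtain C where C: "C \<ge> 0" and IH: "\<And>P w \<delta> D a s e. box_pseudoexp P w u \<delta> D \<Longrightarrow> \<delta> \<le> 1 \<Longrightarrow> 0 \<le> \<delta> \<Longrightarrow>
     (\<forall>i. \<bar>a $ i - u $ i\<bar> \<le> \<delta>) \<Longrightarrow> 0 \<le> s \<Longrightarrow> s \<le> 1 \<Longrightarrow> e + d \<le> D \<Longrightarrow>
     sq_bounded P w e (\<lambda>x. f (a + s *\<^sub>R (x - a)) - f u) (C * \<delta>\<^sup>2)" by blast
  show ?case
  proof (intro exI conjI allI impI)
    \<comment> \<open>With y the contracted point, y_i f(y) - u_i f(u) = (y_i - u_i)(f(y) - f(u)) +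
      u_i (f(y) - f(u)) + f(u)(y_i - u_i). Two uses of \<open>sq_bounded_add\<close> give the
      factors 2.\<close>
    show "0 \<le> 2 * (C + 2 * ((u $ i)\<^sup>2 * C + (f u)\<^sup>2))" using C by simp
    fix P :: "(real ^ 'n) set" and w and \<delta> :: real and D and a :: "real ^ 'n" and s :: real and e :: nat
    assume L: "box_pseudoexp P w u \<delta> D" and \<delta>: "\<delta> \<le> 1" "0 \<le> \<delta>" and a: "\<forall>i. \<bar>a $ i - u $ i\<bar> \<le> \<delta>"
      and s: "0 \<le> s" "s \<le> 1" and e: "e + Suc d \<le> D"
    let ?y = "\<lambda>x. a + s *\<^sub>R (x - a)"
    have L1: "sq_nonneg P w D (\<lambda>_. 1)" using L by (simp add: box_pseudoexp_def)
    have pf: "pdeg d (\<lambda>x. f (?y x) - f u)" by (rule pdeg_diff[OF pdeg_affine[OF pdeg_coord.hyps] pdeg_const])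
    have "pdeg (Suc 0) (\<lambda>x. x $ i)" using pdeg_coord_diff[of i 0] by simp
    from pdeg_diff[OF pdeg_affine[OF this] pdeg_const]
    have py: "pdeg (Suc 0) (\<lambda>x. ?y x $ i - u $ i)" .
    have pf': "pdeg (Suc d) (\<lambda>x. f (?y x) - f u)" by (rule pdeg_Suc[OF pf])
    have py': "pdeg (Suc d) (\<lambda>x. ?y x $ i - u $ i)" by (rule pdeg_mono[OF py]) simp
    have hy: "sq_bounded P w e (\<lambda>x. ?y x $ i - u $ i) (\<delta>\<^sup>2)"
      using e by (intro sq_bounded_coord[OF L] a[rule_format] s) auto
    \<comment> \<open>One degree more than \<open>e\<close>, because in the product term the test
      polynomial is first multiplied by the coordinate difference.\<close>
    have bf: "sq_bounded P w (e + Suc 0) (\<lambda>x. f (?y x) - f u) (C * \<delta>\<^sup>2)"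
      using e by (intro IH[OF L \<delta> a s]) auto
    have bf0: "sq_bounded P w e (\<lambda>x. f (?y x) - f u) (C * \<delta>\<^sup>2)"
      using e by (intro IH[OF L \<delta> a s]) auto
    have "sq_bounded P w e (\<lambda>x. (?y x $ i - u $ i) * (f (?y x) - f u)) (\<delta>\<^sup>2 * (C * \<delta>\<^sup>2))"
      using C by (intro sq_bounded_mult[OF hy py bf]) simp
    \<comment> \<open>Here \<delta> \<le> 1 absorbs the fourth power of \<delta> into the
      second.\<close>
    then have 1: "sq_bounded P w e (\<lambda>x. (?y x $ i - u $ i) * (f (?y x) - f u)) (C * \<delta>\<^sup>2)"
      using e C \<delta> by (elim sq_bounded_weaken[OF _ L1]) (auto simp: mult_left_le_one_le power_le_one)
    have 2: "sq_bounded P w e (\<lambda>x. u $ i * (f (?y x) - f u) + f u * (?y x $ i - u $ i))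
        (2 * ((u $ i)\<^sup>2 * (C * \<delta>\<^sup>2) + (f u)\<^sup>2 * \<delta>\<^sup>2))"
      by (rule sq_bounded_add[OF L1 sq_bounded_cmult[OF bf0] pdeg_cmult[OF pf'] sq_bounded_cmult[OF hy]
            pdeg_cmult[OF py'] e])
    have "sq_bounded P w e (\<lambda>x. (?y x $ i - u $ i) * (f (?y x) - f u) +
        (u $ i * (f (?y x) - f u) + f u * (?y x $ i - u $ i)))
        (2 * (C * \<delta>\<^sup>2 + 2 * ((u $ i)\<^sup>2 * (C * \<delta>\<^sup>2) + (f u)\<^sup>2 * \<delta>\<^sup>2)))"
      by (rule sq_bounded_add[OF L1 1 _ 2 pdeg_add[OF pdeg_cmult[OF pf'] pdeg_cmult[OF py']] e])
        (use pdeg_mult[OF py pf] in simp)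
    then show "sq_bounded P w e (\<lambda>x. ?y x $ i * f (?y x) - u $ i * f u)
        (2 * (C + 2 * ((u $ i)\<^sup>2 * C + (f u)\<^sup>2)) * \<delta>\<^sup>2)"
      by (simp add: algebra_simps)
  qed
next
  case (pdeg_add d f g)
  then obtain C C' where C: "C \<ge> 0" "C' \<ge> 0" and
    IH: "\<And>P w \<delta> D a s e. box_pseudoexp P w u \<delta> D \<Longrightarrow> \<delta> \<le> 1 \<Longrightarrow> 0 \<le> \<delta> \<Longrightarrow>
       (\<forall>i. \<bar>a $ i - u $ i\<bar> \<le> \<delta>) \<Longrightarrow> 0 \<le> s \<Longrightarrow> s \<le> 1 \<Longrightarrow> e + d \<le> D \<Longrightarrow>
       sq_bounded P w e (\<lambda>x. f (a + s *\<^sub>R (x - a)) - f u) (C * \<delta>\<^sup>2)"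
    "\<And>P w \<delta> D a s e. box_pseudoexp P w u \<delta> D \<Longrightarrow> \<delta> \<le> 1 \<Longrightarrow> 0 \<le> \<delta> \<Longrightarrow>
       (\<forall>i. \<bar>a $ i - u $ i\<bar> \<le> \<delta>) \<Longrightarrow> 0 \<le> s \<Longrightarrow> s \<le> 1 \<Longrightarrow> e + d \<le> D \<Longrightarrow>
       sq_bounded P w e (\<lambda>x. g (a + s *\<^sub>R (x - a)) - g u) (C' * \<delta>\<^sup>2)" by blast
  show ?case
  proof (intro exI conjI allI impI)
    show "0 \<le> 2 * (C + C')" using C by simp
    fix P :: "(real ^ 'n) set" and w and \<delta> :: real and D and a :: "real ^ 'n" and s :: real and e :: nat
    assume L: "box_pseudoexp P w u \<delta> D" and \<delta>: "\<delta> \<le> 1" "0 \<le> \<delta>" and a: "\<forall>i. \<bar>a $ i - u $ i\<bar> \<le> \<delta>"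
      and s: "0 \<le> s" "s \<le> 1" and e: "e + d \<le> D"
    have L1: "sq_nonneg P w D (\<lambda>_. 1)" using L by (simp add: box_pseudoexp_def)
    let ?y = "\<lambda>x. a + s *\<^sub>R (x - a)"
    have "sq_bounded P w e (\<lambda>x. (f (?y x) - f u) + (g (?y x) - g u)) (2 * (C * \<delta>\<^sup>2 + C' * \<delta>\<^sup>2))"
      by (rule sq_bounded_add[OF L1 IH(1)[OF L \<delta> a s e] pdeg_diff[OF pdeg_affine[OF pdeg_add.hyps(1)] pdeg_const]
          IH(2)[OF L \<delta> a s e] pdeg_diff[OF pdeg_affine[OF pdeg_add.hyps(2)] pdeg_const] e])
    then show "sq_bounded P w e (\<lambda>x. f (?y x) + g (?y x) - (f u + g u)) (2 * (C + C') * \<delta>\<^sup>2)"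
      by (simp add: algebra_simps)
  qed
next
  case (pdeg_Suc d f)
  then obtain C where C: "C \<ge> 0" and IH: "\<And>P w \<delta> D a s e. box_pseudoexp P w u \<delta> D \<Longrightarrow> \<delta> \<le> 1 \<Longrightarrow> 0 \<le> \<delta> \<Longrightarrow>
     (\<forall>i. \<bar>a $ i - u $ i\<bar> \<le> \<delta>) \<Longrightarrow> 0 \<le> s \<Longrightarrow> s \<le> 1 \<Longrightarrow> e + d \<le> D \<Longrightarrow>
     sq_bounded P w e (\<lambda>x. f (a + s *\<^sub>R (x - a)) - f u) (C * \<delta>\<^sup>2)" by blast
  show ?case
    by (intro exI conjI allI impI, rule C, rule IH) auto
qed

section \<open>Jensen inequalities\<close>

lemma pdeg_has_derivative:
  fixes f :: "real ^ 'n \<Rightarrow> real"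
  assumes "pdeg d f"
  shows "\<exists>G. (\<forall>i. pdeg d (G i)) \<and> (\<forall>x. (f has_derivative (\<lambda>v. \<Sum>i\<in>UNIV. G i x * v $ i)) (at x))"
  using assms
proof (induction rule: pdeg.induct)
  case (pdeg_const d c)
  show ?case by (intro exI[of _ "\<lambda>i x. 0"]) (auto intro: pdeg.pdeg_const)
next
  case (pdeg_coord d f i)
  then obtain G where G: "\<And>j. pdeg d (G j)"
    "\<And>x. (f has_derivative (\<lambda>v. \<Sum>j\<in>UNIV. G j x * v $ j)) (at x)" by blast
  define G' where "G' j x = x $ i * G j x + (if j = i then f x else 0)" for j x
  have "pdeg (Suc d) (G' j)" for j
    unfolding G'_def
    by (cases "j = i") (simp_all add: pdeg_add pdeg.pdeg_coord G pdeg_Suc pdeg_coord.hyps)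
  moreover have "((\<lambda>x. x $ i * f x) has_derivative (\<lambda>v. \<Sum>j\<in>UNIV. G' j x * v $ j)) (at x)" for x
  proof -
    have "((\<lambda>x. x $ i) has_derivative (\<lambda>v. v $ i)) (at x)"
      by (intro bounded_linear_imp_has_derivative bounded_linear_vec_nth)
    moreover have "(\<Sum>j\<in>UNIV. G' j x * v $ j) = x $ i * (\<Sum>j\<in>UNIV. G j x * v $ j) + v $ i * f x" for v
      by (simp add: G'_def distrib_right sum.distrib sum_distrib_left mult.assoc
          if_distrib[of "\<lambda>t. t * _"] cong: if_cong)
    ultimately show ?thesis using has_derivative_mult[OF _ G(2)] by simp
  qed
  ultimately show ?case by blast
next
  case (pdeg_add d f g)
  then obtain G G' where G: "\<And>j. pdeg d (G j)" "\<And>j. pdeg d (G' j)"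
    "\<And>x. (f has_derivative (\<lambda>v. \<Sum>j\<in>UNIV. G j x * v $ j)) (at x)"
    "\<And>x. (g has_derivative (\<lambda>v. \<Sum>j\<in>UNIV. G' j x * v $ j)) (at x)" by blast
  have "((\<lambda>x. f x + g x) has_derivative (\<lambda>v. \<Sum>j\<in>UNIV. (G j x + G' j x) * v $ j)) (at x)" for x
    using has_derivative_add[OF G(3,4)] by (rule has_derivative_eq_rhs) (simp add: distrib_right sum.distrib)
  moreover have "pdeg d (\<lambda>x. G j x + G' j x)" for j by (rule pdeg.pdeg_add[OF G(1,2)])
  ultimately show ?case by (intro exI[of _ "\<lambda>j x. G j x + G' j x"]) blast
next
  case (pdeg_Suc d f)
  then show ?case using pdeg.pdeg_Suc by blast
qed

lemma gradient_eq:
  assumes "\<And>x. (f has_derivative (\<lambda>v. \<Sum>i\<in>UNIV. G i x * v $ i)) (at x)"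
  shows "gradient f x = (\<chi> i. G i x)"
proof -
  have "frechet_derivative f (at x) = (\<lambda>v. \<Sum>i\<in>UNIV. G i x * v $ i)"
    using frechet_derivative_at[OF assms] ..
  then show ?thesis
    by (simp add: gradient_def axis_def if_distrib[of "\<lambda>t. _ * t"] cong: if_cong)
qed

lemma hessian_eq:
  assumes G: "\<And>x. (f has_derivative (\<lambda>v. \<Sum>i\<in>UNIV. G i x * v $ i)) (at x)"
    and H: "\<And>i x. (G i has_derivative (\<lambda>v. \<Sum>j\<in>UNIV. H i j x * v $ j)) (at x)"
  shows "hessian f x $ i $ j = H i j x"
proof -
  have "gradient f = (\<lambda>x. \<chi> i. G i x)" using gradient_eq[OF G] by blast
  moreover have "((\<lambda>x. \<chi> i. G i x) has_derivative (\<lambda>v. \<chi> i. \<Sum>j\<in>UNIV. H i j x * v $ j)) (at x)"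
    by (subst has_derivative_componentwise_within) (auto simp: Basis_vec_def inner_axis H)
  ultimately have "(gradient f has_derivative (\<lambda>v. \<chi> i. \<Sum>j\<in>UNIV. H i j x * v $ j)) (at x)" by simp
  from frechet_derivative_at[OF this, symmetric]
  show ?thesis
    by (simp add: hessian_def jacobian_def matrix_def axis_def if_distrib[of "\<lambda>t. _ * t"] cong: if_cong)
qed

text \<open>Second-order criterion along the segments from the mean \<open>a\<close>. As
  \<open>pexp\<close> is a finite sum, differentiation in \<open>s\<close> is termwise, and the
  hypothesis \<open>neg\<close> is the sign of the second derivative.\<close>

lemma pexp_jensen:
  fixes g :: "real ^ 'n \<Rightarrow> real"
  assumes G: "\<And>x. (g has_derivative (\<lambda>v. \<Sum>i\<in>UNIV. G i x * v $ i)) (at x)"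
    and H: "\<And>i x. (G i has_derivative (\<lambda>v. \<Sum>j\<in>UNIV. H i j x * v $ j)) (at x)"
    and one: "pexp P w (\<lambda>_. 1) = 1" and a: "a = (\<chi> i. pexp P w (\<lambda>x. x $ i))"
    and neg: "\<And>s. 0 \<le> s \<Longrightarrow> s \<le> 1 \<Longrightarrow> pexp P w (\<lambda>x. \<Sum>i\<in>UNIV. \<Sum>j\<in>UNIV.
        (x $ i - a $ i) * (x $ j - a $ j) * H i j (a + s *\<^sub>R (x - a))) \<le> 0"
  shows "pexp P w g \<le> g a"
proof -
  define \<phi> where "\<phi> s = pexp P w (\<lambda>x. g (a + s *\<^sub>R (x - a)))" for s
  define \<psi> where "\<psi> s = pexp P w (\<lambda>x. \<Sum>i\<in>UNIV. (x $ i - a $ i) * G i (a + s *\<^sub>R (x - a)))" for s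
  have chain: "((\<lambda>s. f (a + s *\<^sub>R v)) has_real_derivative (\<Sum>i\<in>UNIV. F i (a + s *\<^sub>R v) * v $ i)) (at s)"
    if f: "\<And>x. (f has_derivative (\<lambda>v. \<Sum>i\<in>UNIV. F i x * v $ i)) (at x)"
    for f :: "real ^ 'n \<Rightarrow> real" and F s v
  proof -
    have "((\<lambda>s. a + s *\<^sub>R v) has_derivative (\<lambda>t. t *\<^sub>R v)) (at s)"
      by (auto intro!: derivative_eq_intros)
    from has_derivative_compose[OF this f] show ?thesis
      unfolding has_field_derivative_def
      by (rule has_derivative_eq_rhs) (auto simp: sum_distrib_left algebra_simps)
  qed
  have d1: "(\<phi> has_real_derivative \<psi> s) (at s)" for s
    unfolding \<phi>_def \<psi>_def pexp_def
    by (intro DERIV_sum DERIV_cmult) (use chain[OF G, where v = "p - a" for p] in \<open>simp add: mult.commute\<close>)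
  have d2: "(\<psi> has_real_derivative pexp P w (\<lambda>x. \<Sum>i\<in>UNIV. \<Sum>j\<in>UNIV.
        (x $ i - a $ i) * (x $ j - a $ j) * H i j (a + s *\<^sub>R (x - a)))) (at s)" for s
  proof -
    have "(\<psi> has_real_derivative pexp P w (\<lambda>x. \<Sum>i\<in>UNIV. (x $ i - a $ i) *
        (\<Sum>j\<in>UNIV. H i j (a + s *\<^sub>R (x - a)) * (x - a) $ j))) (at s)"
      unfolding \<psi>_def pexp_def
      by (intro DERIV_sum DERIV_cmult chain[OF H, where v = "p - a" for p])
    then show ?thesis by (simp add: sum_distrib_left algebra_simps)
  qed
  have "\<psi> 0 = (\<Sum>i\<in>UNIV. pexp P w (\<lambda>x. G i a * (x $ i - a $ i)))"
    by (simp add: \<psi>_def pexp_sum mult.commute)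
  \<comment> \<open>The mass is 1 and \<open>a\<close> is the mean, so the first moments of x - a
    vanish.\<close>
  also have "\<dots> = 0"
    unfolding pexp_cmult pexp_diff pexp_const[of P w "a $ _"] one by (simp add: a)
  finally have "\<psi> 0 = 0" .
  have \<psi>: "\<psi> s \<le> 0" if "0 \<le> s" "s \<le> 1" for s
  proof -
    have "\<psi> s \<le> \<psi> 0"
      using that d2 neg by (intro DERIV_nonpos_imp_nonincreasing[of 0 s \<psi>]) (auto intro: order_trans)
    then show ?thesis by (simp add: \<open>\<psi> 0 = 0\<close>)
  qed
  have "\<phi> 1 \<le> \<phi> 0"
    using d1 \<psi> by (intro DERIV_nonpos_imp_nonincreasing[of 0 1 \<phi>]) auto
  then show ?thesis
    by (simp add: \<phi>_def pexp_const[of P w "g a"] one)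
qed

text \<open>Schur complement induction: \<open>A\<close> is a positive multiple of a square of a linear form plus a form in
  which the variable \<open>k\<close> does not occur.\<close>

lemma posdef_trace_nonneg:
  fixes A m :: "'i \<Rightarrow> 'i \<Rightarrow> real"
  assumes "finite I" "0 < \<epsilon>" "\<And>i j. A i j = A j i"
    and "\<And>v. \<epsilon> * (\<Sum>i\<in>I. (v i)\<^sup>2) \<le> (\<Sum>i\<in>I. \<Sum>j\<in>I. v i * A i j * v j)"
    and "\<And>v. 0 \<le> (\<Sum>i\<in>I. \<Sum>j\<in>I. v i * v j * m i j)"
  shows "0 \<le> (\<Sum>i\<in>I. \<Sum>j\<in>I. A i j * m i j)"
  using assms(1,3-)
proof (induction I arbitrary: A rule: finite_induct)
  case (insert k I)
  have split: "(\<Sum>i\<in>insert k I. \<Sum>j\<in>insert k I. F i j) =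
     F k k + (\<Sum>j\<in>I. F k j) + (\<Sum>i\<in>I. F i k) + (\<Sum>i\<in>I. \<Sum>j\<in>I. F i j)" for F :: "'i \<Rightarrow> 'i \<Rightarrow> real"
    using insert.hyps by (simp add: sum.distrib algebra_simps)
  have zero: "i \<in> I \<Longrightarrow> i \<noteq> k" for i using insert.hyps by auto
  have symk: "i \<in> I \<Longrightarrow> A i k = A k i" for i by (rule insert.prems(1))
  have "\<epsilon> \<le> A k k"
  proof -
    have eqs: "(\<Sum>i\<in>I. (if i = k then 1 else 0 :: real)\<^sup>2) = 0"
      "(\<Sum>j\<in>I. (if k = k then 1 else 0) * A k j * (if j = k then 1 else 0)) = 0"
      "(\<Sum>i\<in>I. (if i = k then 1 else 0) * A i k * (if k = k then 1 else 0)) = 0"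
      "(\<Sum>i\<in>I. \<Sum>j\<in>I. (if i = k then 1 else 0) * A i j * (if j = k then 1 else 0)) = 0"
      by (auto intro!: sum.neutral dest: zero)
    show ?thesis
      using insert.prems(2)[of "\<lambda>i. if i = k then 1 else 0"] insert.hyps unfolding split eqs by (simp add: eqs)
  qed
  then have Ak: "A k k > 0" using assms(2) by simp
  define A' where "A' i j = A i j - A k i * A k j / A k k" for i j
  have "0 \<le> (\<Sum>i\<in>I. \<Sum>j\<in>I. A' i j * m i j)"
  proof (rule insert.IH)
    show "A' i j = A' j i" for i j by (simp add: A'_def insert.prems(1)[of i j] mult.commute)
    show "\<epsilon> * (\<Sum>i\<in>I. (v i)\<^sup>2) \<le> (\<Sum>i\<in>I. \<Sum>j\<in>I. v i * A' i j * v j)" for v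
    proof -
      define S where "S = (\<Sum>j\<in>I. A k j * v j)"
      \<comment> \<open>The entry at \<open>k\<close> minimises the form of \<open>A\<close> in that
        variable; the minimum is the Schur complement form \<open>A'\<close> at
        \<open>v\<close>.\<close>
      define v' where "v' i = (if i = k then - S / A k k else v i)" for i
      have v': "v' k = - S / A k k" "i \<in> I \<Longrightarrow> v' i = v i" for i using zero by (auto simp: v'_def)
      have "\<epsilon> * (\<Sum>i\<in>I. (v i)\<^sup>2) \<le> \<epsilon> * (\<Sum>i\<in>insert k I. (v' i)\<^sup>2)"
        using insert.hyps assms(2) by (simp add: v')
      also have "\<dots> \<le> (\<Sum>i\<in>insert k I. \<Sum>j\<in>insert k I. v' i * A i j * v' j)" by (rule insert.prems)
      also have "\<dots> = v' k * A k k * v' k + v' k * S + S * v' k + (\<Sum>i\<in>I. \<Sum>j\<in>I. v i * A i j * v j)"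
      proof -
        have e: "(\<Sum>j\<in>I. v' k * A k j * v' j) = v' k * S" "(\<Sum>i\<in>I. v' i * A i k * v' k) = S * v' k"
          "(\<Sum>i\<in>I. \<Sum>j\<in>I. v' i * A i j * v' j) = (\<Sum>i\<in>I. \<Sum>j\<in>I. v i * A i j * v j)"
          unfolding S_def sum_distrib_left sum_distrib_right
          by (intro sum.cong refl; simp only: v'(2) mult.assoc; simp add: symk mult.commute)+
        show ?thesis unfolding split e ..
      qed
      also have "v' k * A k k * v' k + v' k * S + S * v' k = - (S * S / A k k)"
        using Ak by (simp add: v'(1) field_simps)
      also have "- (S * S / A k k) + (\<Sum>i\<in>I. \<Sum>j\<in>I. v i * A i j * v j) = (\<Sum>i\<in>I. \<Sum>j\<in>I. v i * A' i j * v j)"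
      proof -
        have "S * S / A k k = (\<Sum>i\<in>I. \<Sum>j\<in>I. A k i * v i * (A k j * v j) / A k k)"
          unfolding S_def sum_product sum_divide_distrib ..
        moreover have "(\<Sum>i\<in>I. \<Sum>j\<in>I. v i * A i j * v j) -
            (\<Sum>i\<in>I. \<Sum>j\<in>I. A k i * v i * (A k j * v j) / A k k) = (\<Sum>i\<in>I. \<Sum>j\<in>I. v i * A' i j * v j)"
          unfolding A'_def sum_subtractf[symmetric]
          by (intro sum.cong refl) (simp add: algebra_simps)
        ultimately show ?thesis by simp
      qed
      finally show ?thesis .
    qed
    show "0 \<le> (\<Sum>i\<in>I. \<Sum>j\<in>I. v i * v j * m i j)" for v
    proof -
      define v' where "v' i = (if i = k then 0 else v i)" for i
      have v': "v' k = 0" "i \<in> I \<Longrightarrow> v' i = v i" for i using zero by (auto simp: v'_def)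
      have "(\<Sum>i\<in>I. \<Sum>j\<in>I. v' i * v' j * m i j) = (\<Sum>i\<in>I. \<Sum>j\<in>I. v i * v j * m i j)"
        by (intro sum.cong refl) (simp add: v')
      then show ?thesis
        using insert.prems(3)[of v'] unfolding split by (simp add: v'(1))
    qed
  qed
  \<comment> \<open>The split-off rank-one part contributes the form of \<open>m\<close> at the
    vector \<open>A k\<close>, divided by the pivot.\<close>
  moreover have "0 \<le> (\<Sum>i\<in>insert k I. \<Sum>j\<in>insert k I. A k i * A k j * m i j) / A k k"
    using insert.prems(3)[of "A k"] Ak by simp
  moreover have "(\<Sum>i\<in>insert k I. \<Sum>j\<in>insert k I. A i j * m i j) =
     (\<Sum>i\<in>insert k I. \<Sum>j\<in>insert k I. A k i * A k j * m i j) / A k k + (\<Sum>i\<in>I. \<Sum>j\<in>I. A' i j * m i j)"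
  proof -
    have "(\<Sum>i\<in>insert k I. \<Sum>j\<in>insert k I. A i j * m i j) -
       (\<Sum>i\<in>insert k I. \<Sum>j\<in>insert k I. A k i * A k j * m i j) / A k k =
       (\<Sum>i\<in>insert k I. \<Sum>j\<in>insert k I. A' i j * m i j)"
      unfolding A'_def sum_divide_distrib sum_subtractf[symmetric]
      by (intro sum.cong refl) (simp add: algebra_simps)
    also have "\<dots> = (\<Sum>i\<in>I. \<Sum>j\<in>I. A' i j * m i j)"
    proof -
      have "A' k j = 0" "A' j k = 0" for j using Ak insert.prems(1)[of j k] by (simp_all add: A'_def)
      then show ?thesis unfolding split by simp
    qed
    finally show ?thesis by simp
  qed
  ultimately show ?case by simp
qed simp

text \<open>Finsler's lemma by compactness. On the part of the unit sphere where \<open>f\<close> is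
  nonpositive, \<open>h\<close> has a positive minimum, so a large multiple of \<open>h\<close>
  makes the sum positive; \<epsilon> is its minimum on the sphere and homogeneity extends the
  bound.\<close>

lemma finsler:
  fixes f h :: "'a::euclidean_space \<Rightarrow> real"
  assumes "continuous_on UNIV f" "continuous_on UNIV h"
    and hom: "\<And>c v. f (c *\<^sub>R v) = c\<^sup>2 * f v" "\<And>c v. h (c *\<^sub>R v) = c\<^sup>2 * h v"
    and h: "\<And>v. 0 \<le> h v" and pos: "\<And>v. v \<noteq> 0 \<Longrightarrow> h v = 0 \<Longrightarrow> 0 < f v"
  shows "\<exists>M \<epsilon>. 0 < \<epsilon> \<and> (\<forall>v. \<epsilon> * (norm v)\<^sup>2 \<le> f v + M * h v)"
proof -
  let ?S = "sphere (0 :: 'a) 1"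
  have cS: "compact ?S" "?S \<noteq> {}" by simp_all
  have cf: "continuous_on T f" "continuous_on T h" for T
    using assms(1,2) continuous_on_subset by blast+
  obtain v0 where v0: "\<And>v. v \<in> ?S \<Longrightarrow> f v0 \<le> f v"
    using continuous_attains_inf[OF cS cf(1)] by blast
  have "\<exists>M\<ge>0. \<forall>v\<in>?S. 0 < f v + M * h v"
  proof (cases "\<exists>v\<in>?S. f v \<le> 0")
    case True
    let ?K = "?S \<inter> f -` {..0}"
    have "closed (f -` {..0})" using continuous_closed_vimage[of "{..0}" f] assms(1)
      by (simp add: continuous_on_eq_continuous_at)
    then have "compact ?K" by (intro compact_Int_closed cS)
    moreover have "?K \<noteq> {}" using True by auto
    ultimately obtain v1 where v1: "v1 \<in> ?K" "\<And>v. v \<in> ?K \<Longrightarrow> h v1 \<le> h v"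
      using continuous_attains_inf[OF _ _ cf(2)] by meson
    have "v1 \<noteq> 0" using v1(1) by auto
    then have m: "h v1 > 0" using v1(1) pos[of v1] h[of v1] by force
    \<comment> \<open>Then \<open>M * h v1\<close> exceeds minus the minimum \<open>f v0\<close> of
      \<open>f\<close> by at least 1, which covers all points where \<open>f\<close> is
      nonpositive.\<close>
    define M where "M = (\<bar>f v0\<bar> + 1) / h v1"
    have "M \<ge> 0" using m by (simp add: M_def)
    moreover have "0 < f v + M * h v" if v: "v \<in> ?S" for v
    proof (cases "f v \<le> 0")
      case True
      then have "h v1 \<le> h v" using v by (intro v1) auto
      then have "M * h v1 \<le> M * h v" using \<open>M \<ge> 0\<close> by (rule mult_left_mono)
      then show ?thesis using v0[OF v] m by (simp add: M_def)
    next
      case False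
      then show ?thesis using \<open>M \<ge> 0\<close> h[of v] by (simp add: add_pos_nonneg)
    qed
    ultimately show ?thesis by blast
  next
    case False
    then show ?thesis by (intro exI[of _ 0]) auto
  qed
  then obtain M where M: "\<And>v. v \<in> ?S \<Longrightarrow> 0 < f v + M * h v" by blast
  have "continuous_on ?S (\<lambda>v. f v + M * h v)" by (intro continuous_intros cf)
  from continuous_attains_inf[OF cS this]
  obtain v2 where v2: "v2 \<in> ?S" "\<And>v. v \<in> ?S \<Longrightarrow> f v2 + M * h v2 \<le> f v + M * h v" by blast
  have "(f v2 + M * h v2) * (norm v)\<^sup>2 \<le> f v + M * h v" for v
  proof (cases "v = 0")
    case True
    then show ?thesis using hom[of 0 0] by simp
  next
    case False
    let ?v = "(1 / norm v) *\<^sub>R v"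
    have "?v \<in> ?S" using False by simp
    then have "f v2 + M * h v2 \<le> (1 / norm v)\<^sup>2 * (f v + M * h v)"
      using v2(2)[of ?v] unfolding hom by (simp add: distrib_left mult.left_commute)
    then show ?thesis using False by (simp add: field_simps)
  qed
  then show ?thesis using M[OF v2(1)] by blast
qed

text \<open>The variance around \<open>a\<close> is nonnegative, so (a - u_i)^2 \<le> L((x_i -
  u_i)^2), and the box constraint bounds the right side by \<delta>^2.\<close>

lemma box_pseudoexp_mean:
  assumes L: "box_pseudoexp P w u \<delta> D" and "1 \<le> D" "0 \<le> \<delta>" and one: "pexp P w (\<lambda>_. 1) = 1"
  shows "\<bar>pexp P w (\<lambda>x. x $ i) - u $ i\<bar> \<le> \<delta>"
proof -
  define a where "a = pexp P w (\<lambda>x. x $ i)"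
  have "0 \<le> pexp P w (\<lambda>x. (x $ i - a)\<^sup>2)"
    using assms(2) by (intro box_pseudoexp_sq[OF L] pdeg_mono[OF pdeg_coord_diff]) simp
  also have "(\<lambda>x. (x $ i - a)\<^sup>2) = (\<lambda>x. (x $ i - u $ i)\<^sup>2 - 2 * (a - u $ i) * (x $ i) + (a\<^sup>2 - (u $ i)\<^sup>2))"
    by (simp add: power2_eq_square algebra_simps)
  also have "pexp P w \<dots> = pexp P w (\<lambda>x. (x $ i - u $ i)\<^sup>2) - 2 * (a - u $ i) * a + (a\<^sup>2 - (u $ i)\<^sup>2)"
    by (simp only: pexp_add pexp_diff pexp_cmult pexp_const[of P w "a\<^sup>2"] pexp_const[of P w "(u $ i)\<^sup>2"] one flip: a_def)
  also have "\<dots> = pexp P w (\<lambda>x. (x $ i - u $ i)\<^sup>2) - (a - u $ i)\<^sup>2"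
    by (simp add: power2_eq_square algebra_simps)
  finally have "(a - u $ i)\<^sup>2 \<le> pexp P w (\<lambda>x. (x $ i - u $ i)\<^sup>2)" by simp
  also have "\<dots> \<le> \<delta>\<^sup>2"
    using box_pseudoexp_box[OF L pdeg_const[of D 1], of i] one by simp
  finally show ?thesis using assms(3) by (simp add: a_def abs_le_square_iff[symmetric])
qed

section \<open>Local Jensen inequalities for the two kinds of active constraints\<close>

text \<open>Uniform over all smaller boxes and all larger degrees, so that several constraints can
  later share one box and one degree.\<close>

definition jensen_near :: "real ^ 'n \<Rightarrow> real \<Rightarrow> nat \<Rightarrow> (real ^ 'n \<Rightarrow> real) \<Rightarrow> bool" where
  "jensen_near u \<delta>0 D0 h \<longleftrightarrow> (\<forall>P w \<delta> D. box_pseudoexp P w u \<delta> D \<longrightarrow> 0 < \<delta> \<longrightarrow> \<delta> \<le> \<delta>0 \<longrightarrow> D0 \<le> D \<longrightarrow>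
     pexp P w (\<lambda>_. 1) = 1 \<longrightarrow> pexp P w h \<le> h (\<chi> i. pexp P w (\<lambda>x. x $ i)))"

text \<open>The second derivative along the segments is -L of the sum over l of the squares of the
  polynomials sum_i W_li(y)(x_i - a_i), with y the contracted point. The Hessian identity is global,
  so every radius works.\<close>

lemma sos_concave_jensen_near:
  fixes g :: "real ^ 'n \<Rightarrow> real"
  assumes "pdeg d g" "sos_concave g"
  shows "\<exists>D0. \<forall>\<delta>0. jensen_near u \<delta>0 D0 g"
proof -
  obtain G where G: "\<And>i. pdeg d (G i)"
    "\<And>x. (g has_derivative (\<lambda>v. \<Sum>i\<in>UNIV. G i x * v $ i)) (at x)"
    using pdeg_has_derivative[OF assms(1)] by blast
  have "\<forall>i. \<exists>H. (\<forall>j. pdeg d (H j)) \<and> (\<forall>x. (G i has_derivative (\<lambda>v. \<Sum>j\<in>UNIV. H j x * v $ j)) (at x))"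
    using pdeg_has_derivative[OF G(1)] by blast
  then obtain H where H: "\<And>i j. pdeg d (H i j)"
    "\<And>i x. (G i has_derivative (\<lambda>v. \<Sum>j\<in>UNIV. H i j x * v $ j)) (at x)" by metis
  obtain r W where W: "\<And>l i. l < r \<Longrightarrow> real_polynomial_function (W l i)"
    "\<And>x i j. (- hessian g x) $ i $ j = (\<Sum>l<(r::nat). W l i x * W l j x)"
    using assms(2) unfolding sos_concave_def by metis
  have "\<forall>l i. \<exists>d. l < r \<longrightarrow> pdeg d (W l i)"
    using W(1) real_polynomial_function_imp_pdeg by blast
  then obtain e where e: "\<And>l i. l < r \<Longrightarrow> pdeg (e l i) (W l i)" by metis
  define D0 where "D0 = (\<Sum>l<r. \<Sum>i\<in>UNIV. e l i)"
  have WD: "pdeg D0 (W l i)" if "l < r" for l i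
  proof -
    have "e l i \<le> (\<Sum>i\<in>UNIV. e l i)" by (rule member_le_sum) auto
    also have "\<dots> \<le> D0" unfolding D0_def using that by (intro member_le_sum) auto
    finally show ?thesis by (rule pdeg_mono[OF e[OF that]])
  qed
  have HW: "- H i j x = (\<Sum>l<r. W l i x * W l j x)" for i j x
    using W(2)[of x i j] hessian_eq[OF G(2) H(2), of x i j] by simp
  show ?thesis
    unfolding jensen_near_def
  proof (intro exI allI impI)
    fix \<delta>0 P w \<delta> and D :: nat
    \<comment> \<open>The existential degree bound becomes \<open>D0 + 1\<close>: the entries of
      \<open>W\<close>, plus one for the linear factor.\<close>
    assume L: "box_pseudoexp P w u \<delta> D" and D: "D0 + 1 \<le> D" and one: "pexp P w (\<lambda>_. 1) = 1"
    define a where "a = (\<chi> i. pexp P w (\<lambda>x. x $ i))"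
    show "pexp P w g \<le> g (\<chi> i. pexp P w (\<lambda>x. x $ i))"
      unfolding a_def[symmetric]
    proof (rule pexp_jensen[OF G(2) H(2) one a_def])
      fix s :: real
      let ?y = "\<lambda>x. a + s *\<^sub>R (x - a)"
      let ?q = "\<lambda>l x. \<Sum>i\<in>UNIV. W l i (?y x) * (x $ i - a $ i)"
      have "0 \<le> pexp P w (\<lambda>x. (?q l x)\<^sup>2)" if "l < r" for l
      proof (rule box_pseudoexp_sq[OF L], rule pdeg_sum)
        fix i
        have "pdeg (D0 + Suc 0) (\<lambda>x. W l i (?y x) * (x $ i - a $ i))"
          by (rule pdeg_mult[OF pdeg_affine[OF WD[OF that]] pdeg_coord_diff])
        then show "pdeg D (\<lambda>x. W l i (?y x) * (x $ i - a $ i))"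
          by (rule pdeg_mono) (use D in simp)
      qed simp
      then have "0 \<le> (\<Sum>l<r. pexp P w (\<lambda>x. (?q l x)\<^sup>2))" by (intro sum_nonneg) simp
      also have "\<dots> = pexp P w (\<lambda>x. \<Sum>l<r. (?q l x)\<^sup>2)" by (rule pexp_sum[symmetric])
      also have "(\<lambda>x. \<Sum>l<r. (?q l x)\<^sup>2) = (\<lambda>x. - 1 * (\<Sum>i\<in>UNIV. \<Sum>j\<in>UNIV.
          (x $ i - a $ i) * (x $ j - a $ j) * H i j (?y x)))"
      proof
        fix x
        have "(\<Sum>l<r. (?q l x)\<^sup>2) = (\<Sum>l<r. \<Sum>i\<in>UNIV. \<Sum>j\<in>UNIV.
            (x $ i - a $ i) * (x $ j - a $ j) * (W l i (?y x) * W l j (?y x)))"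
          unfolding power2_eq_square sum_product by (intro sum.cong refl) (simp add: algebra_simps)
        also have "\<dots> = (\<Sum>i\<in>UNIV. \<Sum>l<r. \<Sum>j\<in>UNIV.
            (x $ i - a $ i) * (x $ j - a $ j) * (W l i (?y x) * W l j (?y x)))"
          by (rule sum.swap)
        also have "\<dots> = (\<Sum>i\<in>UNIV. \<Sum>j\<in>UNIV. \<Sum>l<r.
            (x $ i - a $ i) * (x $ j - a $ j) * (W l i (?y x) * W l j (?y x)))"
          by (intro sum.cong refl sum.swap)
        also have "\<dots> = (\<Sum>i\<in>UNIV. \<Sum>j\<in>UNIV. (x $ i - a $ i) * (x $ j - a $ j) * - H i j (?y x))"
          unfolding HW sum_distrib_left ..
        finally show "(\<Sum>l<r. (?q l x)\<^sup>2) = - 1 * (\<Sum>i\<in>UNIV. \<Sum>j\<in>UNIV.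
          (x $ i - a $ i) * (x $ j - a $ j) * H i j (?y x))" by (simp add: sum_negf)
      qed
      finally show "pexp P w (\<lambda>x. \<Sum>i\<in>UNIV. \<Sum>j\<in>UNIV.
          (x $ i - a $ i) * (x $ j - a $ j) * H i j (?y x)) \<le> 0"
        unfolding pexp_cmult by simp
    qed
  qed
qed

text \<open>The Hessian at the contracted point is its value at \<open>u\<close> plus a remainder
  \<open>R\<close>. With \<open>m\<close> the second moment matrix around the mean, the first part
  contributes at most -\<epsilon>/2 times the trace of \<open>m\<close>, and on a small box the
  remainder at most \<epsilon>/2 times that trace.\<close>

lemma strictly_concave_jensen_near:
  fixes h :: "real ^ 'n \<Rightarrow> real" and u :: "real ^ 'n"
  assumes G: "\<And>x. (h has_derivative (\<lambda>v. \<Sum>i\<in>UNIV. G i x * v $ i)) (at x)"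
    and H: "\<And>i x. (G i has_derivative (\<lambda>v. \<Sum>j\<in>UNIV. H i j x * v $ j)) (at x)"
    and d: "\<And>i j. pdeg d (H i j)" and \<epsilon>: "0 < \<epsilon>"
    and neg: "\<And>v :: real ^ 'n. (\<Sum>i\<in>UNIV. \<Sum>j\<in>UNIV. v $ i * H i j u * v $ j) \<le> - \<epsilon> * (norm v)\<^sup>2"
  shows "\<exists>\<delta>0>0. \<exists>D0. jensen_near u \<delta>0 D0 h"
proof -
  obtain C where C: "\<And>i j. 0 \<le> C i j" and osc:
    "\<And>i j P w \<delta> D a s e. box_pseudoexp P w u \<delta> D \<Longrightarrow> \<delta> \<le> 1 \<Longrightarrow> 0 \<le> \<delta> \<Longrightarrow>
     (\<forall>i. \<bar>a $ i - u $ i\<bar> \<le> \<delta>) \<Longrightarrow> 0 \<le> s \<Longrightarrow> s \<le> 1 \<Longrightarrow> e + d \<le> D \<Longrightarrow>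
     sq_bounded P w e (\<lambda>x. H i j (a + s *\<^sub>R (x - a)) - H i j u) (C i j * \<delta>\<^sup>2)"
    using sq_bounded_oscillation[OF d, of u] by metis
  define C0 where "C0 = (\<Sum>i\<in>UNIV. \<Sum>j\<in>UNIV. C i j)"
  have C0: "C i j \<le> C0" for i j
  proof -
    have "C i j \<le> (\<Sum>j\<in>UNIV. C i j)" using C by (intro member_le_sum) auto
    also have "\<dots> \<le> C0" unfolding C0_def using C by (intro member_le_sum sum_nonneg) auto
    finally show ?thesis .
  qed
  have C0_nn: "0 \<le> C0" using C C0 order_trans by blast
  define N where "N = real CARD('n)"
  have N: "N > 0" by (simp add: N_def)
  \<comment> \<open>Summing \<eta>(m_ii + m_jj) over all pairs gives 2N\<eta> times the trace of
    \<open>m\<close>, which is \<epsilon> times the trace.\<close>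
  define \<eta> where "\<eta> = \<epsilon> / (2 * N)"
  have \<eta>: "\<eta> > 0" using \<epsilon> N by (simp add: \<eta>_def)
  \<comment> \<open>Ensures \<open>C0\<close> \<delta>^2 \<le> \<eta>^2, by way of C0 \<le> (C0 +
    1)^2; the bound 1 is required by \<open>sq_bounded_oscillation\<close>.\<close>
  define \<delta>0 where "\<delta>0 = min 1 (\<eta> / (C0 + 1))"
  have "\<delta>0 > 0" using \<eta> C0_nn by (simp add: \<delta>0_def)
  moreover have "jensen_near u \<delta>0 (d + 1) h"
    unfolding jensen_near_def
  proof (intro allI impI)
    fix P w \<delta> and D :: nat
    assume L: "box_pseudoexp P w u \<delta> D" and \<delta>: "0 < \<delta>" "\<delta> \<le> \<delta>0" and D: "d + 1 \<le> D"
      and one: "pexp P w (\<lambda>_. 1) = 1"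
    have "\<delta> \<le> 1" using \<delta> by (simp add: \<delta>0_def)
    have "\<delta> * (C0 + 1) \<le> \<eta>" using \<delta> C0_nn by (simp add: \<delta>0_def field_simps)
    then have "(\<delta> * (C0 + 1))\<^sup>2 \<le> \<eta>\<^sup>2" using \<delta> C0_nn by (intro power_mono) auto
    moreover have "C0 * \<delta>\<^sup>2 \<le> (\<delta> * (C0 + 1))\<^sup>2"
    proof -
      have "C0 \<le> (C0 + 1)\<^sup>2" using C0_nn by (simp add: power2_eq_square algebra_simps)
      then have "C0 * \<delta>\<^sup>2 \<le> (C0 + 1)\<^sup>2 * \<delta>\<^sup>2" by (intro mult_right_mono) auto
      then show ?thesis by (simp add: power_mult_distrib mult.commute)
    qed
    ultimately have C\<eta>: "C i j * \<delta>\<^sup>2 \<le> \<eta>\<^sup>2" for i j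
      using mult_right_mono[OF C0[of i j], of "\<delta>\<^sup>2"] by simp
    define a where "a = (\<chi> i. pexp P w (\<lambda>x. x $ i))"
    have a: "\<forall>i. \<bar>a $ i - u $ i\<bar> \<le> \<delta>"
      using box_pseudoexp_mean[OF L _ _ one] D \<delta> by (simp add: a_def)
    define z where "z i x = x $ i - a $ i" for i and x :: "real ^ 'n"
    have z: "pdeg (Suc 0) (z i)" for i unfolding z_def by (rule pdeg_coord_diff)
    define m where "m i j = pexp P w (\<lambda>x. z i x * z j x)" for i j
    have m_sym: "m i j = m j i" for i j by (simp add: m_def mult.commute)
    have m_psd: "0 \<le> (\<Sum>i\<in>UNIV. \<Sum>j\<in>UNIV. v i * v j * m i j)" for v
    proof -
      have "pdeg (Suc 0) (\<lambda>x. \<Sum>i\<in>UNIV. v i * z i x)" by (intro pdeg_sum pdeg_cmult z) simp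
      then have "0 \<le> pexp P w (\<lambda>x. (\<Sum>i\<in>UNIV. v i * z i x)\<^sup>2)"
        using D by (intro box_pseudoexp_sq[OF L] pdeg_mono[of "Suc 0" _ D]) auto
      also have "(\<lambda>x. (\<Sum>i\<in>UNIV. v i * z i x)\<^sup>2) =
          (\<lambda>x. \<Sum>i\<in>UNIV. \<Sum>j\<in>UNIV. v i * v j * (z i x * z j x))"
        unfolding power2_eq_square sum_product by (intro ext sum.cong refl) (simp add: algebra_simps)
      finally show ?thesis by (simp only: pexp_sum pexp_cmult m_def)
    qed
    have const: "(\<Sum>i\<in>UNIV. \<Sum>j\<in>UNIV. H i j u * m i j) \<le> - (\<epsilon> / 2) * (\<Sum>i\<in>UNIV. m i i)"
    proof -
      \<comment> \<open>The symmetrised negative Hessian at \<open>u\<close> with half of its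
        definiteness margin removed. The other half keeps \<open>A\<close> positive definite; the
        removed half becomes the trace term.\<close>
      define A where "A i j = - (H i j u + H j i u) / 2 - (if i = j then \<epsilon> / 2 else 0)" for i j
      have form: "(\<Sum>i\<in>UNIV. \<Sum>j\<in>UNIV. A i j * t i j) =
          - (\<Sum>i\<in>UNIV. \<Sum>j\<in>UNIV. H i j u * t i j) - \<epsilon> / 2 * (\<Sum>i\<in>UNIV. t i i)"
        if t: "\<And>i j. t i j = t j i" for t
      proof -
        have "(\<Sum>i\<in>UNIV. \<Sum>j\<in>UNIV. H j i u * t i j) = (\<Sum>j\<in>UNIV. \<Sum>i\<in>UNIV. H j i u * t i j)"
          by (rule sum.swap)
        also have "\<dots> = (\<Sum>i\<in>UNIV. \<Sum>j\<in>UNIV. H i j u * t i j)"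
          by (intro sum.cong refl) (simp add: t)
        finally have sw: "(\<Sum>i\<in>UNIV. \<Sum>j\<in>UNIV. H j i u * t i j) =
          (\<Sum>i\<in>UNIV. \<Sum>j\<in>UNIV. H i j u * t i j)" .
        have "(\<Sum>i\<in>UNIV. \<Sum>j\<in>UNIV. A i j * t i j) = (\<Sum>i\<in>UNIV. \<Sum>j\<in>UNIV.
           (- 1 / 2) * (H i j u * t i j) + (- 1 / 2) * (H j i u * t i j) - (if i = j then \<epsilon> / 2 * t i j else 0))"
          by (intro sum.cong refl) (auto simp: A_def field_simps)
        also have "\<dots> = (- 1 / 2) * (\<Sum>i\<in>UNIV. \<Sum>j\<in>UNIV. H i j u * t i j) +
           (- 1 / 2) * (\<Sum>i\<in>UNIV. \<Sum>j\<in>UNIV. H j i u * t i j) - (\<Sum>i\<in>UNIV. \<epsilon> / 2 * t i i)"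
          by (simp only: sum.distrib sum_subtractf sum_distrib_left) simp
        finally show ?thesis unfolding sw sum_distrib_left[symmetric] by simp
      qed
      have "0 \<le> (\<Sum>i\<in>UNIV. \<Sum>j\<in>UNIV. A i j * m i j)"
      proof (rule posdef_trace_nonneg)
        show "0 < \<epsilon> / 2" using \<epsilon> by simp
        show "A i j = A j i" for i j by (simp add: A_def)
        fix v :: "'n \<Rightarrow> real"
        have "(\<Sum>i\<in>UNIV. \<Sum>j\<in>UNIV. H i j u * (v i * v j)) \<le> - \<epsilon> * (\<Sum>i\<in>UNIV. v i * v i)"
          using neg[of "\<chi> i. v i"]
          by (simp add: norm_eq_sqrt_inner inner_vec_def sum_nonneg algebra_simps)
        moreover have "(\<Sum>i\<in>UNIV. \<Sum>j\<in>UNIV. v i * A i j * v j) = (\<Sum>i\<in>UNIV. \<Sum>j\<in>UNIV. A i j * (v i * v j))"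
          by (simp add: algebra_simps)
        ultimately show "\<epsilon> / 2 * (\<Sum>i\<in>UNIV. (v i)\<^sup>2) \<le> (\<Sum>i\<in>UNIV. \<Sum>j\<in>UNIV. v i * A i j * v j)"
          unfolding form[of "\<lambda>i j. v i * v j", OF mult.commute] by (simp add: power2_eq_square)
      qed (use m_psd in auto)
      then show ?thesis unfolding form[of m, OF m_sym] by simp
    qed
    show "pexp P w h \<le> h (\<chi> i. pexp P w (\<lambda>x. x $ i))"
      unfolding a_def[symmetric]
    proof (rule pexp_jensen[OF G H one a_def])
      fix s :: real assume s: "0 \<le> s" "s \<le> 1"
      define R where "R i j x = H i j (a + s *\<^sub>R (x - a)) - H i j u" for i j x
      \<comment> \<open>Weighted arithmetic-geometric mean from the square of \<eta> z_i - z_j R.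
        The term L(z_j^2 R^2) is bounded by the oscillation estimate with z_j as test polynomial of
        degree 1.\<close>
      have R: "2 * pexp P w (\<lambda>x. z i x * z j x * R i j x) \<le> \<eta> * (m i i + m j j)" for i j
      proof -
        have Rd: "pdeg d (R i j)"
          unfolding R_def by (rule pdeg_diff[OF pdeg_affine[OF d] pdeg_const])
        have "pdeg (Suc d) (\<lambda>x. \<eta> * z i x)" by (rule pdeg_mono[OF pdeg_cmult[OF z]]) simp
        moreover have "pdeg (Suc d) (\<lambda>x. z j x * R i j x)" using pdeg_mult[OF z Rd] by simp
        ultimately have "pdeg (Suc d) (\<lambda>x. \<eta> * z i x - z j x * R i j x)" by (rule pdeg_diff)
        then have "0 \<le> pexp P w (\<lambda>x. (\<eta> * z i x - z j x * R i j x)\<^sup>2)"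
          using D by (intro box_pseudoexp_sq[OF L] pdeg_mono[of "Suc d" _ D]) auto
        also have "(\<lambda>x. (\<eta> * z i x - z j x * R i j x)\<^sup>2) = (\<lambda>x. \<eta>\<^sup>2 * (z i x * z i x)
            - (2 * \<eta>) * (z i x * z j x * R i j x) + (z j x)\<^sup>2 * (R i j x)\<^sup>2)"
          by (simp add: power2_eq_square algebra_simps)
        also have "pexp P w \<dots> = \<eta>\<^sup>2 * m i i - 2 * \<eta> * pexp P w (\<lambda>x. z i x * z j x * R i j x)
            + pexp P w (\<lambda>x. (z j x)\<^sup>2 * (R i j x)\<^sup>2)"
          by (simp only: pexp_add pexp_diff pexp_cmult m_def)
        also have "pexp P w (\<lambda>x. (z j x)\<^sup>2 * (R i j x)\<^sup>2) \<le> C i j * \<delta>\<^sup>2 * pexp P w (\<lambda>x. (z j x)\<^sup>2)"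
          using osc[OF L \<open>\<delta> \<le> 1\<close> less_imp_le[OF \<delta>(1)] a s, of "Suc 0" i j] D z[of j]
          by (simp add: sq_bounded_def R_def)
        also have "C i j * \<delta>\<^sup>2 * pexp P w (\<lambda>x. (z j x)\<^sup>2) \<le> \<eta>\<^sup>2 * pexp P w (\<lambda>x. (z j x)\<^sup>2)"
          using D by (intro mult_right_mono C\<eta> box_pseudoexp_sq[OF L] pdeg_mono[OF z]) auto
        also have "pexp P w (\<lambda>x. (z j x)\<^sup>2) = m j j" by (simp add: m_def power2_eq_square)
        finally have "\<eta> * (2 * pexp P w (\<lambda>x. z i x * z j x * R i j x)) \<le> \<eta> * (\<eta> * (m i i + m j j))"
          by (simp add: power2_eq_square algebra_simps)
        then show ?thesis using \<eta> by simp
      qed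
      have "(\<Sum>i\<in>UNIV. \<Sum>j\<in>UNIV. 2 * pexp P w (\<lambda>x. z i x * z j x * R i j x))
          \<le> (\<Sum>i\<in>UNIV. \<Sum>j\<in>UNIV. \<eta> * (m i i + m j j))"
        by (intro sum_mono R)
      also have "\<dots> = \<eta> * (2 * N * (\<Sum>i\<in>UNIV. m i i))"
        by (simp add: sum.distrib distrib_left N_def flip: sum_distrib_left)
      also have "\<dots> = \<epsilon> * (\<Sum>i\<in>UNIV. m i i)" using N by (simp add: \<eta>_def)
      finally have var: "2 * (\<Sum>i\<in>UNIV. \<Sum>j\<in>UNIV. pexp P w (\<lambda>x. z i x * z j x * R i j x))
          \<le> \<epsilon> * (\<Sum>i\<in>UNIV. m i i)" by (simp only: sum_distrib_left)
      have "pexp P w (\<lambda>x. z i x * z j x * H i j (a + s *\<^sub>R (x - a))) =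
          H i j u * m i j + pexp P w (\<lambda>x. z i x * z j x * R i j x)" for i j
        unfolding m_def pexp_cmult[symmetric] pexp_add[symmetric] by (simp add: R_def algebra_simps)
      then have "pexp P w (\<lambda>x. \<Sum>i\<in>UNIV. \<Sum>j\<in>UNIV. z i x * z j x * H i j (a + s *\<^sub>R (x - a))) =
          (\<Sum>i\<in>UNIV. \<Sum>j\<in>UNIV. H i j u * m i j) +
          (\<Sum>i\<in>UNIV. \<Sum>j\<in>UNIV. pexp P w (\<lambda>x. z i x * z j x * R i j x))"
        by (simp only: pexp_sum sum.distrib)
      also have "\<dots> \<le> 0" using const var by simp
      finally show "pexp P w (\<lambda>x. \<Sum>i\<in>UNIV. \<Sum>j\<in>UNIV. (x $ i - a $ i) * (x $ j - a $ j) *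
         H i j (a + s *\<^sub>R (x - a))) \<le> 0" by (simp only: z_def)
    qed
  qed
  ultimately show ?thesis by blast
qed

lemma eventually_nhds_box:
  fixes u :: "real ^ 'n"
  assumes "eventually Q (nhds u)"
  shows "\<exists>\<delta>>0. \<forall>x. (\<forall>i. \<bar>x $ i - u $ i\<bar> \<le> \<delta>) \<longrightarrow> Q x"
proof -
  obtain r where r: "r > 0" "\<And>x. dist x u < r \<Longrightarrow> Q x"
    using assms by (auto simp: eventually_nhds_metric)
  define \<delta> where "\<delta> = r / (2 * real CARD('n))"
  have "Q x" if x: "\<forall>i. \<bar>x $ i - u $ i\<bar> \<le> \<delta>" for x
  proof (rule r(2))
    have "dist x u \<le> (\<Sum>i\<in>UNIV. \<bar>(x - u) $ i\<bar>)" unfolding dist_norm by (rule norm_le_l1_cart)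
    also have "\<dots> \<le> (\<Sum>i\<in>(UNIV :: 'n set). \<delta>)" using x by (intro sum_mono) simp
    also have "\<dots> < r" using r(1) by (simp add: \<delta>_def)
    finally show "dist x u < r" .
  qed
  moreover have "\<delta> > 0" using r(1) by (simp add: \<delta>_def)
  ultimately show ?thesis by blast
qed

text \<open>Since g(u) = 0, the Hessian at \<open>u\<close> of g - (M/2) g^2 is that of
  \<open>g\<close> minus M times the square of the gradient as a form. Finsler's lemma supplies an M
  making it negative definite.\<close>

lemma strictly_quasi_concave_jensen_near:
  fixes g :: "real ^ 'n \<Rightarrow> real"
  assumes g: "pdeg d g" and u: "g u = 0" and sqc: "strictly_quasi_concave_at g u"
  shows "\<exists>h. \<exists>\<delta>0>0. \<exists>D0. (\<forall>x. (\<forall>i. \<bar>x $ i - u $ i\<bar> \<le> \<delta>0) \<longrightarrow> (0 \<le> h x \<longleftrightarrow> 0 \<le> g x)) \<and> jensen_near u \<delta>0 D0 h"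
proof -
  obtain G where G: "\<And>i. pdeg d (G i)"
    "\<And>x. (g has_derivative (\<lambda>v. \<Sum>i\<in>UNIV. G i x * v $ i)) (at x)"
    using pdeg_has_derivative[OF g] by blast
  have "\<forall>i. \<exists>H. (\<forall>j. pdeg d (H j)) \<and> (\<forall>x. (G i has_derivative (\<lambda>v. \<Sum>j\<in>UNIV. H j x * v $ j)) (at x))"
    using pdeg_has_derivative[OF G(1)] by blast
  then obtain H where H: "\<And>i j. pdeg d (H i j)"
    "\<And>i x. (G i has_derivative (\<lambda>v. \<Sum>j\<in>UNIV. H i j x * v $ j)) (at x)" by metis
  define f where "f v = - (\<Sum>i\<in>UNIV. \<Sum>j\<in>UNIV. v $ i * H i j u * v $ j)" for v :: "real ^ 'n"
  define k where "k v = (\<Sum>i\<in>UNIV. G i u * v $ i)\<^sup>2" for v :: "real ^ 'n"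
  have "v \<bullet> (hessian g u *v v) = (\<Sum>i\<in>UNIV. \<Sum>j\<in>UNIV. v $ i * H i j u * v $ j)" for v
    by (simp add: inner_vec_def matrix_vector_mult_def hessian_eq[OF G(2) H(2)] sum_distrib_left mult.assoc)
  moreover have "gradient g u \<bullet> v = (\<Sum>i\<in>UNIV. G i u * v $ i)" for v
    by (simp add: gradient_eq[OF G(2)] inner_vec_def)
  \<comment> \<open>Vanishing of \<open>k v\<close> means that \<open>v\<close> is orthogonal to the
    gradient, so this is strict quasi-concavity; a zero gradient makes \<open>k\<close> vanish
    identically.\<close>
  ultimately have pos: "0 < f v" if "v \<noteq> 0" "k v = 0" for v
    using sqc that unfolding strictly_quasi_concave_at_def f_def k_def by simp
  have "\<exists>M \<epsilon>. 0 < \<epsilon> \<and> (\<forall>v. \<epsilon> * (norm v)\<^sup>2 \<le> f v + M * k v)"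
  proof (rule finsler)
    show "continuous_on UNIV f" unfolding f_def by (intro continuous_intros)
    show "continuous_on UNIV k" unfolding k_def by (intro continuous_intros)
    show "f (c *\<^sub>R v) = c\<^sup>2 * f v" for c v
      by (simp add: f_def sum_distrib_left power2_eq_square algebra_simps)
    show "k (c *\<^sub>R v) = c\<^sup>2 * k v" for c v
    proof -
      have "(\<Sum>i\<in>UNIV. G i u * (c *\<^sub>R v) $ i) = c * (\<Sum>i\<in>UNIV. G i u * v $ i)"
        by (simp add: sum_distrib_left algebra_simps)
      then show ?thesis by (simp add: k_def power_mult_distrib)
    qed
    show "0 \<le> k v" for v by (simp add: k_def)
  qed (rule pos)
  then obtain M \<epsilon> where \<epsilon>: "0 < \<epsilon>" and M: "\<And>v. \<epsilon> * (norm v)\<^sup>2 \<le> f v + M * k v" by blast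
  define h where "h x = g x - M / 2 * (g x * g x)" for x
  define G' where "G' i x = G i x - M * (g x * G i x)" for i x
  define H' where "H' i j x = H i j x - M * (G j x * G i x + g x * H i j x)" for i j x
  define S where "S x v = (\<Sum>i\<in>UNIV. G i x * v $ i)" for x and v :: "real ^ 'n"
  define T where "T i x v = (\<Sum>j\<in>UNIV. H i j x * v $ j)" for i x and v :: "real ^ 'n"
  have dS: "(g has_derivative S x) (at x)" and dT: "(G i has_derivative T i x) (at x)" for i x
    unfolding S_def T_def by (rule G(2), rule H(2))
  have hG: "(h has_derivative (\<lambda>v. \<Sum>i\<in>UNIV. G' i x * v $ i)) (at x)" for x
  proof -
    have "(\<Sum>i\<in>UNIV. G' i x * v $ i) = S x v - M * (g x * S x v)" for v
      by (simp add: G'_def S_def left_diff_distrib sum_subtractf sum_distrib_left mult.assoc)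
    moreover have "(h has_derivative (\<lambda>v. S x v - M / 2 * (g x * S x v + S x v * g x))) (at x)"
      unfolding h_def
      by (rule has_derivative_diff[OF dS has_derivative_mult_right[OF has_derivative_mult[OF dS dS]]])
    ultimately show ?thesis by (simp add: mult.commute)
  qed
  have hH: "(G' i has_derivative (\<lambda>v. \<Sum>j\<in>UNIV. H' i j x * v $ j)) (at x)" for i x
  proof -
    have "(\<Sum>j\<in>UNIV. H' i j x * v $ j) = T i x v - M * (g x * T i x v + S x v * G i x)" for v
      unfolding H'_def S_def T_def sum_distrib_left sum_distrib_right sum.distrib[symmetric] sum_subtractf[symmetric]
      by (intro sum.cong refl) (simp add: algebra_simps)
    moreover have "(G' i has_derivative (\<lambda>v. T i x v - M * (g x * T i x v + S x v * G i x))) (at x)"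
      unfolding G'_def
      by (rule has_derivative_diff[OF dT has_derivative_mult_right[OF has_derivative_mult[OF dS dT]]])
    ultimately show ?thesis by simp
  qed
  have "pdeg (d + d) (H' i j)" for i j
    unfolding H'_def
    by (intro pdeg_diff pdeg_cmult pdeg_add pdeg_mult g G(1) H(1) pdeg_mono[OF H(1)]) simp
  moreover have "(\<Sum>i\<in>UNIV. \<Sum>j\<in>UNIV. v $ i * H' i j u * v $ j) \<le> - \<epsilon> * (norm v)\<^sup>2" for v
  proof -
    have "(\<Sum>i\<in>UNIV. \<Sum>j\<in>UNIV. v $ i * H' i j u * v $ j) =
      (\<Sum>i\<in>UNIV. \<Sum>j\<in>UNIV. v $ i * H i j u * v $ j - M * (G i u * v $ i * (G j u * v $ j)))"
      by (intro sum.cong refl) (simp add: H'_def u algebra_simps)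
    also have "\<dots> = - f v - M * k v"
      unfolding f_def k_def power2_eq_square sum_product by (simp add: sum_subtractf sum_distrib_left)
    finally show ?thesis using M[of v] by simp
  qed
  ultimately obtain \<delta>1 D0 where \<delta>1: "\<delta>1 > 0" "jensen_near u \<delta>1 D0 h"
    using strictly_concave_jensen_near[OF hG hH _ \<epsilon>] by blast
  \<comment> \<open>h = (1 - (M/2) g) g, and the first factor is close to 1 near \<open>u\<close>
    because g(u) = 0. Hence \<open>h\<close> and \<open>g\<close> have the same sign there.\<close>
  have "isCont g u" using G(2) by (rule has_derivative_continuous)
  then have "(g \<longlongrightarrow> g u) (nhds u)" by (simp add: isCont_def tendsto_at_iff_tendsto_nhds)
  then have "((\<lambda>x. 1 - M / 2 * g x) \<longlongrightarrow> 1 - M / 2 * g u) (nhds u)"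
    by (intro tendsto_intros)
  then have "\<forall>\<^sub>F x in nhds u. 0 < 1 - M / 2 * g x"
    using order_tendstoD(1)[of "\<lambda>x. 1 - M / 2 * g x" _ _ 0] u by simp
  then obtain \<delta>2 where \<delta>2: "\<delta>2 > 0" "\<And>x. (\<forall>i. \<bar>x $ i - u $ i\<bar> \<le> \<delta>2) \<Longrightarrow> 0 < 1 - M / 2 * g x"
    using eventually_nhds_box by blast
  define \<delta>0 where "\<delta>0 = min \<delta>1 \<delta>2"
  have "0 \<le> h x \<longleftrightarrow> 0 \<le> g x" if "\<forall>i. \<bar>x $ i - u $ i\<bar> \<le> \<delta>0" for x
  proof -
    have "0 < 1 - M / 2 * g x" using that by (intro \<delta>2(2)) (auto simp: \<delta>0_def)
    moreover have "h x = (1 - M / 2 * g x) * g x" by (simp add: h_def algebra_simps)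
    ultimately show ?thesis by (simp add: zero_le_mult_iff)
  qed
  moreover have "jensen_near u \<delta>0 D0 h"
    using \<delta>1(2) by (auto simp: jensen_near_def \<delta>0_def)
  moreover have "\<delta>0 > 0" using \<delta>1 \<delta>2 by (simp add: \<delta>0_def)
  ultimately show ?thesis by blast
qed

section \<open>Covering by local pieces\<close>

lemma jensen_near_mono:
  "jensen_near u \<delta>0 D0 h \<Longrightarrow> \<delta>1 \<le> \<delta>0 \<Longrightarrow> D0 \<le> D1 \<Longrightarrow> jensen_near u \<delta>1 D1 h"
  by (auto simp: jensen_near_def)

text \<open>Near an interior point no inequality is imposed. Near a boundary point each constraint
  is replaced by a function with the same nonnegativity set near \<open>u\<close> that satisfies the
  local Jensen inequality; finitely many radii and degrees are then unified.\<close>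

lemma local_description:
  fixes m :: nat and g :: "nat \<Rightarrow> real ^ 'n \<Rightarrow> real" and S :: "(real ^ 'n) set"
  assumes poly: "\<And>i. i \<in> {1..m} \<Longrightarrow> real_polynomial_function (g i)"
    and S_eq: "S = {x. \<forall>i\<in>{1..m}. g i x \<ge> 0}" and "closed S"
    and boundary: "\<And>u i. u \<in> frontier S \<Longrightarrow> i \<in> {1..m} \<Longrightarrow> g i u = 0 \<Longrightarrow>
           sos_concave (g i) \<or> strictly_quasi_concave_at (g i) u"
    and u: "u \<in> S"
  shows "\<exists>\<delta>>0. \<exists>D Hs. finite Hs \<and> (\<forall>h\<in>Hs. jensen_near u \<delta> D h) \<and>
    (\<forall>x. (\<forall>i. \<bar>x $ i - u $ i\<bar> \<le> \<delta>) \<longrightarrow> (x \<in> S \<longleftrightarrow> (\<forall>h\<in>Hs. 0 \<le> h x)))"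
proof (cases "u \<in> interior S")
  case True
  then have "eventually (\<lambda>x. x \<in> S) (nhds u)"
    by (auto simp: eventually_nhds interior_def)
  then obtain \<delta> where "\<delta> > 0" "\<And>x. (\<forall>i. \<bar>x $ i - u $ i\<bar> \<le> \<delta>) \<Longrightarrow> x \<in> S"
    using eventually_nhds_box by blast
  then show ?thesis by (intro exI[of _ \<delta>] conjI exI[of _ 0] exI[of _ "{}"]) auto
next
  case False
  then have uf: "u \<in> frontier S" using u \<open>closed S\<close> by (simp add: frontier_def)
  have "\<exists>h \<delta> D. 0 < \<delta> \<and> (\<forall>x. (\<forall>j. \<bar>x $ j - u $ j\<bar> \<le> \<delta>) \<longrightarrow> (0 \<le> h x \<longleftrightarrow> 0 \<le> g i x)) \<and>
      jensen_near u \<delta> D h" if i: "i \<in> {1..m}" for i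
  proof -
    obtain d where d: "pdeg d (g i)" using real_polynomial_function_imp_pdeg[OF poly[OF i]] by blast
    consider "g i u \<noteq> 0" | "g i u = 0" "sos_concave (g i)" | "g i u = 0" "strictly_quasi_concave_at (g i) u"
      using boundary[OF uf i] by blast
    then show ?thesis
    proof cases
      case 1
      then have "0 < g i u" using u i S_eq by force
      moreover have "isCont (g i) u"
        using pdeg_has_derivative[OF d] has_derivative_continuous by blast
      then have "(g i \<longlongrightarrow> g i u) (nhds u)"
        by (simp add: isCont_def tendsto_at_iff_tendsto_nhds)
      ultimately have "\<forall>\<^sub>F x in nhds u. 0 < g i x" using order_tendstoD(1) by blast
      then obtain \<delta> where "\<delta> > 0" "\<And>x. (\<forall>j. \<bar>x $ j - u $ j\<bar> \<le> \<delta>) \<Longrightarrow> 0 < g i x"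
        using eventually_nhds_box by blast
      \<comment> \<open>A constraint that is positive at \<open>u\<close> stays positive on a box,
        so the constant 1 replaces it; Jensen is an equality for it at mass 1.\<close>
      then show ?thesis
        by (intro exI[of _ "\<lambda>_. 1"] exI[of _ \<delta>] exI[of _ 0]) (auto simp: jensen_near_def less_imp_le)
    next
      case 2
      from sos_concave_jensen_near[OF d 2(2)] obtain D where "\<And>\<delta>. jensen_near u \<delta> D (g i)" by blast
      then show ?thesis by (intro exI[of _ "g i"] exI[of _ 1] exI[of _ D]) auto
    next
      case 3
      from strictly_quasi_concave_jensen_near[OF d 3] show ?thesis by blast
    qed
  qed
  then obtain h \<delta> D where h: "\<And>i. i \<in> {1..m} \<Longrightarrow> 0 < \<delta> i"
    "\<And>i x. i \<in> {1..m} \<Longrightarrow> (\<forall>j. \<bar>x $ j - u $ j\<bar> \<le> \<delta> i) \<Longrightarrow> (0 \<le> h i x \<longleftrightarrow> 0 \<le> g i x)"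
    "\<And>i. i \<in> {1..m} \<Longrightarrow> jensen_near u (\<delta> i) (D i) (h i)"
    by metis
  \<comment> \<open>The element 1 keeps the minimum meaningful when there are no
    constraints.\<close>
  define \<delta>0 where "\<delta>0 = Min (insert 1 (\<delta> ` {1..m}))"
  define D0 where "D0 = (\<Sum>i=1..m. D i)"
  have \<delta>0: "i \<in> {1..m} \<Longrightarrow> \<delta>0 \<le> \<delta> i" for i
    unfolding \<delta>0_def by (rule Min_le) auto
  have \<delta>0_pos: "0 < \<delta>0"
    unfolding \<delta>0_def using h(1) by (subst Min_gr_iff) auto
  have D0: "i \<in> {1..m} \<Longrightarrow> D i \<le> D0" for i
    unfolding D0_def by (rule member_le_sum) auto
  have "x \<in> S \<longleftrightarrow> (\<forall>k\<in>h ` {1..m}. 0 \<le> k x)" if x: "\<forall>j. \<bar>x $ j - u $ j\<bar> \<le> \<delta>0" for x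
  proof -
    have "0 \<le> h i x \<longleftrightarrow> 0 \<le> g i x" if i: "i \<in> {1..m}" for i
      using x \<delta>0[OF i] by (intro h(2)[OF i]) (meson order_trans)
    then show ?thesis by (auto simp: S_eq)
  qed
  moreover have "\<forall>k\<in>h ` {1..m}. jensen_near u \<delta>0 D0 k"
    using jensen_near_mono[OF h(3) \<delta>0 D0] by blast
  ultimately show ?thesis
    using \<delta>0_pos by (intro exI[of _ \<delta>0] conjI exI[of _ D0] exI[of _ "h ` {1..m}"]) auto
qed

text \<open>A functional that is nonnegative on squares times each \<open>h\<close> in
  \<open>H\<close> has its mass and first moments in the cone over \<open>S\<close>. Conversely all
  of \<open>H\<close> is nonnegative on \<open>S\<close> inside the ball, since the ball lies in the
  box.\<close>

lemma local_piece:
  fixes S :: "(real ^ 'n) set"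
  assumes \<delta>: "0 < \<delta>" and fin: "finite Hs" and jensen: "\<And>h. h \<in> Hs \<Longrightarrow> jensen_near u \<delta> D0 h"
    and S: "\<And>x. (\<forall>i. \<bar>x $ i - u $ i\<bar> \<le> \<delta>) \<Longrightarrow> x \<in> S \<longleftrightarrow> (\<forall>h\<in>Hs. 0 \<le> h x)" and u: "u \<in> S"
  shows "\<exists>H D. finite H \<and> (\<forall>x\<in>S \<inter> ball u \<delta>. \<forall>h\<in>H. 0 \<le> h x) \<and>
    (\<forall>P w. (\<forall>h\<in>H. sq_nonneg P w D h) \<longrightarrow> 0 \<le> pexp P w (\<lambda>_. 1) \<and>
       (\<exists>y\<in>S. \<forall>i. pexp P w (\<lambda>x. x $ i) = pexp P w (\<lambda>_. 1) * y $ i))"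
proof -
  define H where "H = insert (\<lambda>_. 1) (range (\<lambda>i x. \<delta>\<^sup>2 - (x $ i - u $ i)\<^sup>2) \<union> Hs)"
  \<comment> \<open>At least 1, as the bound on the mean tests with linear polynomials.\<close>
  define D where "D = D0 + 1"
  have "finite H" using fin by (simp add: H_def)
  moreover have "0 \<le> h x" if x: "x \<in> S" "x \<in> ball u \<delta>" and h: "h \<in> H" for x h
  proof -
    have b: "\<bar>x $ i - u $ i\<bar> \<le> \<delta>" for i
      using component_le_norm_cart[of "x - u" i] x(2) by (simp add: dist_norm norm_minus_commute)
    then have "(x $ i - u $ i)\<^sup>2 \<le> \<delta>\<^sup>2" for i using \<delta> by (simp flip: abs_le_square_iff)
    then show ?thesis using h S[of x] b x(1) by (auto simp: H_def)
  qed
  moreover have "0 \<le> pexp P w (\<lambda>_. 1) \<and> (\<exists>y\<in>S. \<forall>i. pexp P w (\<lambda>x. x $ i) = pexp P w (\<lambda>_. 1) * y $ i)"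
    if L: "\<forall>h\<in>H. sq_nonneg P w D h" for P w
  proof -
    have box: "box_pseudoexp P w u \<delta> D" using L by (simp add: H_def box_pseudoexp_def)
    define l where "l = pexp P w (\<lambda>_. 1)"
    have "0 \<le> l" using box_pseudoexp_sq[OF box pdeg_const[of D 1]] by (simp add: l_def)
    show ?thesis
    proof (cases "l = 0")
      case True \<comment> \<open>the box constraint gives \<open>L ((x\<^sub>i - u\<^sub>i)\<^sup>2) = 0\<close>, and Cauchy--Schwarz kills the first moments\<close>
      have "pexp P w (\<lambda>x. x $ i) = 0" for i
      proof -
        define e where "e = pexp P w (\<lambda>x. x $ i - u $ i)"
        have sq: "pexp P w (\<lambda>x. (x $ i - u $ i)\<^sup>2) \<le> 0"
          using box_pseudoexp_box[OF box pdeg_const[of D 1], of i] True by (simp add: l_def)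
        have "pdeg D (\<lambda>x. x $ i - (u $ i + e))"
          by (rule pdeg_mono[OF pdeg_coord_diff]) (simp add: D_def)
        then have "0 \<le> pexp P w (\<lambda>x. (x $ i - (u $ i + e))\<^sup>2)" by (rule box_pseudoexp_sq[OF box])
        also have "(\<lambda>x. (x $ i - (u $ i + e))\<^sup>2) = (\<lambda>x. (x $ i - u $ i)\<^sup>2 - 2 * e * (x $ i - u $ i) + e\<^sup>2)"
          by (simp add: power2_eq_square algebra_simps)
        also have "pexp P w \<dots> = pexp P w (\<lambda>x. (x $ i - u $ i)\<^sup>2) - 2 * e * e + e\<^sup>2 * l"
          unfolding pexp_add pexp_diff[of _ _ "\<lambda>x. (x $ i - u $ i)\<^sup>2"] pexp_cmult pexp_const[of P w "e\<^sup>2"]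
          by (simp add: e_def l_def)
        finally have "2 * (e * e) \<le> 0" using sq True by simp
        then have "e = 0" using zero_le_square[of e] by auto
        then show ?thesis
          using True pexp_const[of P w "u $ i"] by (simp add: e_def pexp_diff l_def)
      qed
      then show ?thesis using True u by (auto simp: l_def)
    next
      case False
      then have l: "0 < l" using \<open>0 \<le> l\<close> by simp
      \<comment> \<open>Rescaling to mass 1 preserves all the inequalities and makes the Jensen
        inequalities applicable.\<close>
      define w' where "w' p = w p / l" for p
      have w': "pexp P w' f = pexp P w f / l" for f
        by (simp add: pexp_def w'_def sum_divide_distrib)
      have L': "sq_nonneg P w' D h" if "h \<in> H" for h
        using L that l by (simp add: sq_nonneg_def w')
      have box': "box_pseudoexp P w' u \<delta> D" using L' by (simp add: H_def box_pseudoexp_def)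
      have one: "pexp P w' (\<lambda>_. 1) = 1" using l by (simp add: w' flip: l_def)
      define a where "a = (\<chi> i. pexp P w' (\<lambda>x. x $ i))"
      have "\<bar>a $ i - u $ i\<bar> \<le> \<delta>" for i
        using box_pseudoexp_mean[OF box' _ _ one] \<delta> by (simp add: a_def D_def)
      moreover have "0 \<le> h a" if h: "h \<in> Hs" for h
      proof -
        \<comment> \<open>The constraint on \<open>h\<close> tested with \<open>q\<close> =
          1.\<close>
        have "0 \<le> pexp P w' h"
          using L'[of h] h pdeg_const[of D 1] by (force simp: H_def sq_nonneg_def)
        also have "\<dots> \<le> h a"
          using jensen[OF h] box' \<delta> one by (simp add: jensen_near_def a_def D_def)
        finally show ?thesis .
      qed
      ultimately have "a \<in> S" using S by blast
      moreover have "pexp P w (\<lambda>x. x $ i) = l * a $ i" for i using l by (simp add: a_def w')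
      ultimately show ?thesis using l by (auto simp: l_def)
    qed
  qed
  ultimately show ?thesis by blast
qed

section \<open>Gluing the local pieces into one linear matrix inequality\<close>

text \<open>The lifting variables are the weights \<open>w u p\<close>, in which all conditions are
  affine jointly with \<open>x\<close>. Blocks \<open>Inl (u, h)\<close> are localizing matrices;
  blocks \<open>Inr\<close> encode the equations for the total mass (\<open>None\<close>) and for
  each coordinate (\<open>Some i\<close>).\<close>

lemma SDP_representable_sum_pexp:
  fixes U :: "'u set" and P :: "'u \<Rightarrow> (real ^ 'n) set" and S :: "(real ^ 'n) set"
  assumes "finite U" and fP: "\<And>u. u \<in> U \<Longrightarrow> finite (P u)"
    and fH: "\<And>u. u \<in> U \<Longrightarrow> finite (H u)" and fB: "\<And>u. u \<in> U \<Longrightarrow> finite (B u)"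
    and S: "\<And>x. x \<in> S \<longleftrightarrow> (\<exists>w. (\<forall>u\<in>U. \<forall>h\<in>H u. \<forall>q\<in>fspan (B u). 0 \<le> pexp (P u) (w u) (\<lambda>x. h x * (q x)\<^sup>2)) \<and>
       (\<Sum>u\<in>U. pexp (P u) (w u) (\<lambda>_. 1)) = 1 \<and> (\<forall>i. (\<Sum>u\<in>U. pexp (P u) (w u) (\<lambda>x. x $ i)) = x $ i))"
  shows "SDP_representable S"
proof -
  define C :: "('u \<times> (real ^ 'n \<Rightarrow> real) + bool \<times> 'n option) set" where
    "C = Inl ` Sigma U H \<union> range Inr"
  \<comment> \<open>Scalar conditions are 1 by 1 blocks; the row label \<open>\<lambda>_. 0\<close>
    is a dummy.\<close>
  define R where "R c = (case c of Inl (u, h) \<Rightarrow> B u | Inr _ \<Rightarrow> {\<lambda>_. 0})"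
    for c :: "'u \<times> (real ^ 'n \<Rightarrow> real) + bool \<times> 'n option"
  \<comment> \<open>Each equation is written as two inequalities with opposite signs.\<close>
  define sg where "sg b = (if b then 1 else - 1 :: real)" for b
  define A0 where "A0 c (r :: real ^ 'n \<Rightarrow> real) (s :: real ^ 'n \<Rightarrow> real) =
      (case c of Inr (b, None) \<Rightarrow> - sg b | _ \<Rightarrow> 0)"
    for c :: "'u \<times> (real ^ 'n \<Rightarrow> real) + bool \<times> 'n option" and r s
  define A where "A i c (r :: real ^ 'n \<Rightarrow> real) (s :: real ^ 'n \<Rightarrow> real) =
      (case c of Inr (b, Some j) \<Rightarrow> if i = j then - sg b else 0 | _ \<Rightarrow> 0)"
    for i and c :: "'u \<times> (real ^ 'n \<Rightarrow> real) + bool \<times> 'n option" and r s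
  define E where "E k c r s = (case k of (u, p) \<Rightarrow> (case c of Inl (u', h) \<Rightarrow> if u = u' then h p * (r p * s p) else 0
      | Inr (b, None) \<Rightarrow> sg b | Inr (b, Some j) \<Rightarrow> sg b * p $ j))"
    for k :: "'u \<times> (real ^ 'n)" and c :: "'u \<times> (real ^ 'n \<Rightarrow> real) + bool \<times> 'n option" and r s
  let ?J = "Sigma U P"
  let ?K = "\<lambda>x w c r s. A0 c r s + (\<Sum>i\<in>UNIV. x $ i * A i c r s) + (\<Sum>k\<in>?J. w k * E k c r s)"
  have J: "(\<Sum>k\<in>?J. f k) = (\<Sum>u\<in>U. \<Sum>p\<in>P u. f (u, p))" for f :: "'u \<times> (real ^ 'n) \<Rightarrow> real"
    using assms(1) fP by (subst sum.Sigma) (auto simp: case_prod_beta)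
  have K1: "(\<Sum>r\<in>R (Inl (u, h)). \<Sum>s\<in>R (Inl (u, h)). v r * ?K x w (Inl (u, h)) r s * v s) =
      pexp (P u) (\<lambda>p. w (u, p)) (\<lambda>x. h x * (\<Sum>r\<in>B u. v r * r x)\<^sup>2)" if "u \<in> U" for x w u h v
  proof -
    have "?K x w (Inl (u, h)) r s = (\<Sum>u'\<in>U. if u' = u then \<Sum>p\<in>P u. w (u, p) * (h p * (r p * s p)) else 0)" for r s
      unfolding J by (auto simp: A0_def A_def E_def intro!: sum.cong)
    also have "\<dots> r s = pexp (P u) (\<lambda>p. w (u, p)) (\<lambda>p. h p * (r p * s p))" for r s
      using that assms(1) by (simp add: pexp_def)
    finally have K: "?K x w (Inl (u, h)) r s = pexp (P u) (\<lambda>p. w (u, p)) (\<lambda>p. h p * (r p * s p))" for r s .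
    have sq: "(\<lambda>x. h x * (\<Sum>r\<in>B u. v r * r x)\<^sup>2) =
        (\<lambda>x. \<Sum>r\<in>B u. \<Sum>s\<in>B u. v r * v s * (h x * (r x * s x)))"
      unfolding power2_eq_square sum_product unfolding sum_distrib_left
      by (intro ext sum.cong refl) (simp add: algebra_simps)
    show ?thesis
      unfolding K sq pexp_sum pexp_cmult by (simp add: R_def mult_ac)
  qed
  have K2: "(\<Sum>r\<in>R (Inr (b, None)). \<Sum>s\<in>R (Inr (b, None)). v r * ?K x w (Inr (b, None)) r s * v s) =
      (v (\<lambda>_. 0))\<^sup>2 * (sg b * ((\<Sum>u\<in>U. pexp (P u) (\<lambda>p. w (u, p)) (\<lambda>_. 1)) - 1))" for x w b v
    unfolding J by (simp add: R_def A0_def A_def E_def pexp_def power2_eq_square sum_distrib_left algebra_simps)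
  have K3: "(\<Sum>r\<in>R (Inr (b, Some i)). \<Sum>s\<in>R (Inr (b, Some i)). v r * ?K x w (Inr (b, Some i)) r s * v s) =
      (v (\<lambda>_. 0))\<^sup>2 * (sg b * ((\<Sum>u\<in>U. pexp (P u) (\<lambda>p. w (u, p)) (\<lambda>x. x $ i)) - x $ i))" for x w b v i
    unfolding J by (simp add: R_def A0_def A_def E_def pexp_def power2_eq_square sum_distrib_left algebra_simps
        if_distrib[of "\<lambda>t. _ * t"] cong: if_cong)
  have sg: "(\<forall>b v. 0 \<le> (v z)\<^sup>2 * (sg b * t)) \<longleftrightarrow> t = 0" for z :: "real ^ 'n \<Rightarrow> real" and t
  proof
    assume *: "\<forall>b v. 0 \<le> (v z)\<^sup>2 * (sg b * t)"
    show "t = 0"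
      using *[rule_format, of "\<lambda>_. 1" True] *[rule_format, of "\<lambda>_. 1" False] by (simp add: sg_def)
  qed simp
  have eqv: "(\<forall>c\<in>C. \<forall>v. 0 \<le> (\<Sum>r\<in>R c. \<Sum>s\<in>R c. v r * ?K x w c r s * v s)) \<longleftrightarrow>
      (\<forall>u\<in>U. \<forall>h\<in>H u. \<forall>q\<in>fspan (B u). 0 \<le> pexp (P u) (\<lambda>p. w (u, p)) (\<lambda>x. h x * (q x)\<^sup>2)) \<and>
       (\<Sum>u\<in>U. pexp (P u) (\<lambda>p. w (u, p)) (\<lambda>_. 1)) = 1 \<and>
       (\<forall>i. (\<Sum>u\<in>U. pexp (P u) (\<lambda>p. w (u, p)) (\<lambda>x. x $ i)) = x $ i)" for x w
  proof -
    define Q where "Q c \<longleftrightarrow> (\<forall>v. 0 \<le> (\<Sum>r\<in>R c. \<Sum>s\<in>R c. v r * ?K x w c r s * v s))" for c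
    have "(\<forall>c\<in>C. Q c) \<longleftrightarrow> (\<forall>u\<in>U. \<forall>h\<in>H u. Q (Inl (u, h))) \<and> (\<forall>b. Q (Inr (b, None))) \<and>
        (\<forall>i b. Q (Inr (b, Some i)))"
      unfolding C_def ball_Un by (auto simp: split_paired_all) (metis option.exhaust)
    moreover have "Q (Inl (u, h)) \<longleftrightarrow> (\<forall>q\<in>fspan (B u). 0 \<le> pexp (P u) (\<lambda>p. w (u, p)) (\<lambda>x. h x * (q x)\<^sup>2))"
      if "u \<in> U" for u h
      unfolding Q_def K1[OF that] fspan_def by auto
    moreover have "(\<forall>b. Q (Inr (b, None))) \<longleftrightarrow> (\<Sum>u\<in>U. pexp (P u) (\<lambda>p. w (u, p)) (\<lambda>_. 1)) = 1"
      unfolding Q_def K2 sg by auto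
    moreover have "(\<forall>b. Q (Inr (b, Some i))) \<longleftrightarrow> (\<Sum>u\<in>U. pexp (P u) (\<lambda>p. w (u, p)) (\<lambda>x. x $ i)) = x $ i" for i
      unfolding Q_def K3 sg by auto
    ultimately show ?thesis unfolding Q_def by simp
  qed
  show ?thesis
  proof (rule SDP_representableI[where C = C and J = ?J and R = R and ?A0.0 = A0 and A = A and B = E])
    show "finite C" using assms(1) fH by (simp add: C_def)
    show "finite ?J" using assms(1) fP by auto
    show "finite (R c)" if "c \<in> C" for c using that fB by (auto simp: C_def R_def)
    show "A0 c r s = A0 c s r" for c r s by (simp add: A0_def)
    show "A i c r s = A i c s r" for i c r s by (simp add: A_def)
    show "E k c r s = E k c s r" for k c r s by (auto simp: E_def mult.commute split: prod.split sum.split)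
    show "x \<in> S \<longleftrightarrow> (\<exists>w. \<forall>c\<in>C. \<forall>v. 0 \<le> (\<Sum>r\<in>R c. \<Sum>s\<in>R c. v r * ?K x w c r s * v s))" for x
      unfolding eqv S
    proof
      assume "\<exists>w. (\<forall>u\<in>U. \<forall>h\<in>H u. \<forall>q\<in>fspan (B u). 0 \<le> pexp (P u) (w u) (\<lambda>x. h x * (q x)\<^sup>2)) \<and>
       (\<Sum>u\<in>U. pexp (P u) (w u) (\<lambda>_. 1)) = 1 \<and> (\<forall>i. (\<Sum>u\<in>U. pexp (P u) (w u) (\<lambda>x. x $ i)) = x $ i)"
        (is "\<exists>w. ?Q w")
      then obtain w where "?Q w" ..
      then show "\<exists>w. (\<forall>u\<in>U. \<forall>h\<in>H u. \<forall>q\<in>fspan (B u). 0 \<le> pexp (P u) (\<lambda>p. w (u, p)) (\<lambda>x. h x * (q x)\<^sup>2)) \<and>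
       (\<Sum>u\<in>U. pexp (P u) (\<lambda>p. w (u, p)) (\<lambda>_. 1)) = 1 \<and>
       (\<forall>i. (\<Sum>u\<in>U. pexp (P u) (\<lambda>p. w (u, p)) (\<lambda>x. x $ i)) = x $ i)"
        by (intro exI[of _ "\<lambda>(u, p). w u p"]) simp
    next
      assume "\<exists>w. (\<forall>u\<in>U. \<forall>h\<in>H u. \<forall>q\<in>fspan (B u). 0 \<le> pexp (P u) (\<lambda>p. w (u, p)) (\<lambda>x. h x * (q x)\<^sup>2)) \<and>
       (\<Sum>u\<in>U. pexp (P u) (\<lambda>p. w (u, p)) (\<lambda>_. 1)) = 1 \<and>
       (\<forall>i. (\<Sum>u\<in>U. pexp (P u) (\<lambda>p. w (u, p)) (\<lambda>x. x $ i)) = x $ i)" (is "\<exists>w. ?Q w")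
      then obtain w where "?Q w" ..
      then show "\<exists>w. (\<forall>u\<in>U. \<forall>h\<in>H u. \<forall>q\<in>fspan (B u). 0 \<le> pexp (P u) (w u) (\<lambda>x. h x * (q x)\<^sup>2)) \<and>
       (\<Sum>u\<in>U. pexp (P u) (w u) (\<lambda>_. 1)) = 1 \<and> (\<forall>i. (\<Sum>u\<in>U. pexp (P u) (w u) (\<lambda>x. x $ i)) = x $ i)"
        by (intro exI[of _ "\<lambda>u p. w (u, p)"])
    qed
  qed
qed

theorem theorem3p3:
  fixes m :: nat and g :: "nat \<Rightarrow> real ^ 'n \<Rightarrow> real" and S :: "(real ^ 'n) set"
  assumes poly: "\<And>i. i \<in> {1..m} \<Longrightarrow> real_polynomial_function (g i)"
    and S_eq: "S = {x. \<forall>i\<in>{1..m}. g i x \<ge> 0}"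
    and "compact S" and "convex S" and "interior S \<noteq> {}"
    and boundary: "\<And>u i. u \<in> frontier S \<Longrightarrow> i \<in> {1..m} \<Longrightarrow> g i u = 0 \<Longrightarrow>
           sos_concave (g i) \<or> strictly_quasi_concave_at (g i) u"
  shows "SDP_representable S"
proof -
  have "closed S" using \<open>compact S\<close> by (rule compact_imp_closed)
  define good where "good u \<delta> H D \<longleftrightarrow> finite H \<and> (\<forall>x\<in>S \<inter> ball u \<delta>. \<forall>h\<in>H. 0 \<le> h x) \<and>
    (\<forall>P w. (\<forall>h\<in>H. sq_nonneg P w D h) \<longrightarrow> 0 \<le> pexp P w (\<lambda>_. 1) \<and>
       (\<exists>y\<in>S. \<forall>i. pexp P w (\<lambda>x. x $ i) = pexp P w (\<lambda>_. 1) * y $ i))" for u \<delta> H D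
  have "\<exists>\<delta> H D. 0 < \<delta> \<and> good u \<delta> H D" if u: "u \<in> S" for u
  proof -
    from local_description[OF poly S_eq \<open>closed S\<close> boundary u]
    obtain \<delta> D Hs where *: "0 < \<delta>" "finite Hs" "\<And>h. h \<in> Hs \<Longrightarrow> jensen_near u \<delta> D h"
      "\<And>x. (\<forall>i. \<bar>x $ i - u $ i\<bar> \<le> \<delta>) \<Longrightarrow> x \<in> S \<longleftrightarrow> (\<forall>h\<in>Hs. 0 \<le> h x)" by blast
    from local_piece[OF * u] have "\<exists>H D. good u \<delta> H D" unfolding good_def .
    then show ?thesis using *(1) by blast
  qed
  then obtain \<delta> H D where \<delta>: "\<And>u. u \<in> S \<Longrightarrow> 0 < \<delta> u" and good: "\<And>u. u \<in> S \<Longrightarrow> good u (\<delta> u) (H u) (D u)"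
    by metis
  have H: "finite (H u)" if "u \<in> S" for u
    using good[OF that] unfolding good_def by (elim conjE)
  have H_nonneg: "0 \<le> h x" if "u \<in> S" "x \<in> S" "x \<in> ball u (\<delta> u)" "h \<in> H u" for u x h
    using good[OF that(1)] that(2-) unfolding good_def by (elim conjE) blast
  have sound: "0 \<le> pexp P w (\<lambda>_. 1) \<and> (\<exists>y\<in>S. \<forall>i. pexp P w (\<lambda>x. x $ i) = pexp P w (\<lambda>_. 1) * y $ i)"
    if "u \<in> S" "\<forall>h\<in>H u. sq_nonneg P w (D u) h" for u P w
    using good[OF that(1)] that(2) unfolding good_def by (elim conjE allE impE) (assumption | rule conjI)+
  \<comment> \<open>Compactness leaves finitely many pieces.\<close>
  have "S \<subseteq> (\<Union>u\<in>S. ball u (\<delta> u))" using \<delta> by auto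
  then obtain U where U: "U \<subseteq> S" "finite U" "S \<subseteq> (\<Union>u\<in>U. ball u (\<delta> u))"
    using compactE_image[OF \<open>compact S\<close>, of S "\<lambda>u. ball u (\<delta> u)"] by (metis open_ball)
  have "\<forall>u. \<exists>B. finite B \<and> (\<forall>f :: real ^ 'n \<Rightarrow> real. pdeg (D u) f \<longrightarrow> f \<in> fspan B)"
    using pdeg_finite_span by blast
  then obtain B where B: "\<And>u. finite (B u)"
    "\<And>u f :: real ^ 'n \<Rightarrow> real. pdeg (D u) f \<Longrightarrow> f \<in> fspan (B u)" by metis
  \<comment> \<open>Interpolation has to be exact on the mass, the coordinates and the entries of
    the localizing matrices.\<close>
  define F where "F u = insert (\<lambda>_. 1) (range (\<lambda>i x. x $ i) \<union>
     (\<lambda>(h, r, s) x. h x * (r x * s x)) ` (H u \<times> B u \<times> B u))" for u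
  have "\<exists>P. finite P \<and> (\<forall>x. \<exists>w. \<forall>f\<in>F u. f x = (\<Sum>p\<in>P. w p * f p))" if "u \<in> S" for u
    by (rule interpolation_points) (simp add: F_def H[OF that] B(1))
  then obtain P where P: "\<And>u. u \<in> S \<Longrightarrow> finite (P u)"
    "\<And>u x. u \<in> S \<Longrightarrow> \<exists>w. \<forall>f\<in>F u. f x = pexp (P u) w f"
    unfolding pexp_def by metis
  show ?thesis
  proof (rule SDP_representable_sum_pexp[OF \<open>finite U\<close>])
    show "finite (P u)" "finite (H u)" "finite (B u)" if "u \<in> U" for u
      using that U P H B by blast+
    fix x :: "real ^ 'n"
    show "x \<in> S \<longleftrightarrow> (\<exists>w. (\<forall>u\<in>U. \<forall>h\<in>H u. \<forall>q\<in>fspan (B u). 0 \<le> pexp (P u) (w u) (\<lambda>x. h x * (q x)\<^sup>2)) \<and>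
       (\<Sum>u\<in>U. pexp (P u) (w u) (\<lambda>_. 1)) = 1 \<and> (\<forall>i. (\<Sum>u\<in>U. pexp (P u) (w u) (\<lambda>x. x $ i)) = x $ i))"
      (is "_ \<longleftrightarrow> (\<exists>w. ?Q w)")
    proof
      assume x: "x \<in> S"
      then obtain u where u: "u \<in> U" "x \<in> ball u (\<delta> u)" using U(3) by blast
      then have uS: "u \<in> S" using U(1) by blast
      obtain w where w: "\<And>f. f \<in> F u \<Longrightarrow> f x = pexp (P u) w f" using P(2)[OF uS] by blast
      \<comment> \<open>The point evaluation at \<open>x\<close> is placed on one piece whose ball
        contains \<open>x\<close>; all other pieces carry the zero functional.\<close>
      define w' where "w' u' p = (if u' = u then w p else 0)" for u' p
      have w'_u: "w' u = w" by (simp add: w'_def fun_eq_iff)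
      have w'_ne: "pexp (P u') (w' u') f = 0" if "u' \<noteq> u" for u' f
        using that by (simp add: pexp_def w'_def)
      have sum: "(\<Sum>u'\<in>U. pexp (P u') (w' u') f) = pexp (P u) w f" for f
      proof -
        have "(\<Sum>u'\<in>U. pexp (P u') (w' u') f) = (\<Sum>u'\<in>U. if u' = u then pexp (P u) w f else 0)"
          by (intro sum.cong refl) (auto simp: w'_u w'_ne)
        then show ?thesis using U(2) u(1) by simp
      qed
      have "0 \<le> pexp (P u) w (\<lambda>x. h x * (q x)\<^sup>2)" if h: "h \<in> H u" and q: "q \<in> fspan (B u)" for h q
      proof -
        obtain c where c: "q = (\<lambda>x. \<Sum>b\<in>B u. c b * b x)" using q by (auto simp: fspan_def)
        have hq: "(\<lambda>x. h x * (q x)\<^sup>2) = (\<lambda>x. \<Sum>r\<in>B u. \<Sum>s\<in>B u. c r * c s * (h x * (r x * s x)))"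
          unfolding power2_eq_square c sum_product unfolding sum_distrib_left
          by (intro ext sum.cong refl) (simp add: algebra_simps)
        have "pexp (P u) w (\<lambda>x. h x * (r x * s x)) = h x * (r x * s x)" if "r \<in> B u" "s \<in> B u" for r s
          using w[of "\<lambda>x. h x * (r x * s x)"] h that by (force simp: F_def)
        then have "pexp (P u) w (\<lambda>x. h x * (q x)\<^sup>2) = h x * (q x)\<^sup>2"
          unfolding fun_cong[OF hq, of x] unfolding hq by (simp add: pexp_sum pexp_cmult)
        then show ?thesis using H_nonneg[OF uS x u(2) h] by simp
      qed
      then have "?Q w'"
        using w[of "\<lambda>_. 1"] w[of "\<lambda>x. x $ i" for i] w'_ne
        unfolding sum by (auto simp: F_def) (metis order_refl w'_u)
      then show "\<exists>w. ?Q w" by (rule exI[of _ w'])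
    next
      assume "\<exists>w. ?Q w"
      then obtain w where w: "?Q w" ..
      \<comment> \<open>\<open>fspan (B u)\<close> contains every polynomial with degree bound
        \<open>D u\<close>, so the matrix inequality covers all test polynomials.\<close>
      have "\<forall>h\<in>H u. sq_nonneg (P u) (w u) (D u) h" if "u \<in> U" for u
        using w that B(2) unfolding sq_nonneg_def by blast
      then have *: "0 \<le> pexp (P u) (w u) (\<lambda>_. 1) \<and>
         (\<exists>y\<in>S. \<forall>i. pexp (P u) (w u) (\<lambda>x. x $ i) = pexp (P u) (w u) (\<lambda>_. 1) * y $ i)" if "u \<in> U" for u
        using that U(1) by (intro sound) auto
      then obtain y where y: "\<And>u. u \<in> U \<Longrightarrow> y u \<in> S"
        "\<And>u i. u \<in> U \<Longrightarrow> pexp (P u) (w u) (\<lambda>x. x $ i) = pexp (P u) (w u) (\<lambda>_. 1) * y u $ i"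
        by metis
      \<comment> \<open>The masses are nonnegative and sum to 1, so \<open>x\<close> is a convex
        combination of points of \<open>S\<close>.\<close>
      have "(\<Sum>u\<in>U. pexp (P u) (w u) (\<lambda>_. 1) *\<^sub>R y u) \<in> S"
        using w * y(1) by (intro convex_sum[OF U(2) \<open>convex S\<close>]) auto
      also have "(\<Sum>u\<in>U. pexp (P u) (w u) (\<lambda>_. 1) *\<^sub>R y u) = x"
        using w y(2) by (simp add: vec_eq_iff sum_component)
      finally show "x \<in> S" .
    qed
  qed
qed

end
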